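(* (1) Let $\widetilde V=V\cup\{\delta\}$ be a finite connected graph with weights $\widetilde W$ and root vertex $\delta$. For any $a\in\widetilde V$, $s\in\mathbb{R}$ and any smooth bounded function $g$ with rapid decay (of the variables $\widetilde{\mathbf x},\widetilde{\mathbf y},\widetilde{\boldsymbol\xi},\widetilde{\boldsymbol\eta},\widetilde{\mathbf u}$ indexed by $\widetilde V$), $$\left\langle\frac{z_a}{z_\delta}\int_{\mathbb{R}^{|V|}}g(\widetilde{\mathbf x},\widetilde{\mathbf y},\widetilde{\boldsymbol\xi},\widetilde{\boldsymbol\eta},\widetilde{\mathbf u})\,d\nu_a^{\widetilde W,\widetilde{\mathbf z}}(\widetilde{\mathbf u})\right\rangle_{\widetilde W,\,v_\delta=\theta_s(0)}=\int_{\mathbb{R}^{|V|}}\big\llbracket g(\widetilde{\mathbf x},\widetilde{\mathbf y},\widetilde{\boldsymbol\xi},\widetilde{\boldsymbol\eta},\widetilde{\mathbf u})\big\rrbracket_{\widetilde{A^{\mathbf u}},\,X_\delta=\theta_s(0)}\,d\nu_a^{\widetilde W,\mathbf 1}(\widetilde{\mathbf u}).$$ (2) Let $V$ be a finite connected graph with weights $W$, with a distinguished (root) vertex $\delta$ at which the fields are pinned. For any $b\in V$, $s\in\mathbb{R}$ and any smooth bounded function $g$ with rapid decay (of variables indexed by $V$), $$\left\langle\int_{\mathbb{R}^{|V|-1}}g(\mathbf x,\mathbf y,\boldsymbol\xi,\boldsymbol\eta,\mathbf u)\,d\nu_b^{W,\mathbf z}(\mathbf u)\right\rangle_{W,\,v_\delta=\theta_s(0)}=\int_{\mathbb{R}^{|V|-1}}\big\llbracket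 g(\mathbf x,\mathbf y,\boldsymbol\xi,\boldsymbol\eta,\mathbf u)\big\rrbracket_{A^{\mathbf u},\,X_\delta=\theta_s(0)}\,d\nu_b^{W,\mathbf 1}(\mathbf u).$$
   Context: All definitions are given for a generic finite connected graph with vertex set $U$ and symmetric weights $w_{ij}=w_{ji}\ge0$, $w_{ii}=0$ (weight $0$ means no edge), edge set $E(U)$, and are applied with $(U,w)=(\widetilde V,\widetilde W)$ in part (1) and $(U,w)=(V,W)$ in part (2); $\delta\in U$ is the root, which is the pinned vertex. **Mixing measure.** For $i_0\in U$ and $\boldsymbol\vartheta=(\vartheta_i)_{i\in U}$ positive, $\nu_{i_0}^{w,\boldsymbol\vartheta}$ is the measure on $\mathbf u=(u_i)_{i\in U}$ with $u_{i_0}=0$ (so on $\mathbb{R}^{|U|-1}$): $$d\nu_{i_0}^{w,\boldsymbol\vartheta}(\mathbf u)=\mathbf 1_{\{u_{i_0}=0\}}e^{-\frac12\sum_{(ij)\in E(U)}w_{ij}(e^{u_i-u_j}\vartheta_j^2+e^{u_j-u_i}\vartheta_i^2-2\vartheta_i\vartheta_j)}\sqrt{D(w,\mathbf u)}\prod_{i\in U,\,i\ne i_0}\frac{\vartheta_ie^{-u_i}du_i}{\sqrt{2\pi}},$$ where $D(w,\mathbf u)=\sum_T\prod_{(ij)\in E(T)}w_{ij}e^{u_i+u_j}$, the sum being over spanning trees $T$ of the graph. $\mathbf 1$ is the all-ones vector. When $\boldsymbol\vartheta=\mathbf z$ is the vector of even Grassmann elements $z_i$ below, the density is understood by Taylor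 expansion in nilpotent parts. **Grassmann calculus.** To each $i\in U$ are associated real variables $x_i,y_i$ and anticommuting variables $\xi_i,\eta_i$. Smooth functions of even elements are defined by Taylor expansion in the nilpotent part; a "function" $g$ of $(\mathbf x,\mathbf y,\boldsymbol\xi,\boldsymbol\eta,\mathbf u)$ is a polynomial in the Grassmann variables whose coefficients are functions of $(\mathbf x,\mathbf y,\mathbf u)$. Grassmann integration is left differentiation: $\int d\xi\,f=\partial_\xi f$. **$\mathrm{H}^{2|2}$ expectation.** $z_i=\sqrt{1+x_i^2+y_i^2+2\xi_i\eta_i}$, $v_i=(x_i,y_i,z_i,\xi_i,\eta_i)$, $v_i\cdot v_j=x_ix_j+y_iy_j-z_iz_j+\xi_i\eta_j+\xi_j\eta_i$, and $$\langle F\rangle_{w,\,v_\delta=\theta_s(0)}=\int F\;e^{\sum_{(ij)\in E(U)}w_{ij}(v_i\cdot v_j+1)}\prod_{i\in U\setminus\{\delta\}}\frac1{2\pi}\frac{dx_i\,dy_i}{z_i}d\xi_i\,d\eta_i,$$ with $v_\delta$ fixed to $\theta_s(0)=(\sinh s,0,\cosh s,0,0)$ (coordinates $(x,y,z,\xi,\eta)$), the image of the origin $(0,0,1,0,0)$ under the Lorentz boost $\theta_s(x,y,z,\xi,\eta)=(x\cosh s+z\sinh s,\,y,\,z\cosh s+x\sinh s,\,\xi,\eta)$. **Supersymmetric free field in environment $\mathbf u$.** $A^{\mathbf u}$ is the matrix indexed by $U$ with $A^{\mathbf u}_{ij}=-w_{ij}$ for $i\neq j$ and $A^{\mathbf u}_{ii}=\sum_{k\ne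 i}w_{ik}e^{u_k-u_i}$ (written $\widetilde{A^{\mathbf u}}$ when $U=\widetilde V$). With $X_i=(x_i,y_i,\xi_i,\eta_i)$, $X_i\cdot X_j=x_ix_j+y_iy_j+\xi_i\eta_j+\xi_j\eta_i$, $$\llbracket F\rrbracket_{A^{\mathbf u},\,X_\delta=\theta_s(0)}=\int F\;e^{-\frac12\sum_{i,j\in U}A^{\mathbf u}_{ij}X_i\cdot X_j}\prod_{i\in U\setminus\{\delta\}}\frac1{2\pi}dx_i\,dy_i\,d\xi_i\,d\eta_i,$$ with $X_\delta$ fixed to $\theta_s(0)=(\sinh s,0,0,0)$. (Equivalently $\llbracket F(X)\rrbracket_{A^{\mathbf u}}=\llbracket F(e^{\mathbf u}X)\rrbracket_{B^{\mathbf u}}$ where $B^{\mathbf u}=e^{\mathbf u}A^{\mathbf u}e^{\mathbf u}$ and $e^{\mathbf u}$ is the diagonal matrix with entries $e^{u_i}$.)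
   Formalization: Part (2) as displayed fails for b ≠ δ (the two sides differ by a factor z_δ/z_b inside the bracket); it is proved for all b with the factor z_b/z_δ inserted on the left, as in part (1), and exactly as displayed when b = δ. *)

theory Defs
  imports "HOL-Analysis.Analysis"
begin

section \<open>The Grassmann algebra\<close>

text \<open>
  Over a finite vertex type \<open>'v\<close> there are the generators \<open>\<xi>\<^sub>i = Inl i\<close> and \<open>\<eta>\<^sub>i = Inr i\<close>.
  Generators are numbered by an arbitrary but fixed bijection \<open>gidx\<close>; an element of the algebra
  is given by its coefficients on the basis monomials \<open>e\<^sub>I\<close> (\<open>I\<close> a set of generators), where
  \<open>e\<^sub>I\<close> is the product of the generators in \<open>I\<close> in increasing order.
\<close>

typedef 'v grassmann = "UNIV :: (('v + 'v) set \<Rightarrow> real) set"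
  morphisms gcoeff Grassmann ..

setup_lifting type_definition_grassmann

definition gidx :: "'v::finite + 'v \<Rightarrow> nat"
  where "gidx = to_nat_on UNIV"

text \<open>For disjoint \<open>I\<close> and \<open>J\<close> one has \<open>e\<^sub>I e\<^sub>J = reorder_sign I J \<cdot> e\<^bsub>I \<union> J\<^esub>\<close>.\<close>

definition reorder_sign :: "('v::finite + 'v) set \<Rightarrow> ('v + 'v) set \<Rightarrow> real"
  where "reorder_sign I J = (- 1) ^ card {(p, q). p \<in> I \<and> q \<in> J \<and> gidx q < gidx p}"

lemma reorder_sign_empty [simp]: "reorder_sign {} J = 1" "reorder_sign I {} = 1"
  by (simp_all add: reorder_sign_def)

lemma reorder_sign_Un_left:
  assumes "I \<inter> J = {}"
  shows "reorder_sign (I \<union> J) L = reorder_sign I L * reorder_sign J L"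
proof -
  have eq: "{(p, q). p \<in> I \<union> J \<and> q \<in> L \<and> gidx q < gidx p} =
     {(p, q). p \<in> I \<and> q \<in> L \<and> gidx q < gidx p} \<union> {(p, q). p \<in> J \<and> q \<in> L \<and> gidx q < gidx p}"
    by auto
  show ?thesis
    unfolding reorder_sign_def eq
    by (subst card_Un_disjoint) (use assms in \<open>auto simp: power_add\<close>)
qed

lemma reorder_sign_Un_right:
  assumes "J \<inter> L = {}"
  shows "reorder_sign I (J \<union> L) = reorder_sign I J * reorder_sign I L"
proof -
  have eq: "{(p, q). p \<in> I \<and> q \<in> J \<union> L \<and> gidx q < gidx p} =
     {(p, q). p \<in> I \<and> q \<in> J \<and> gidx q < gidx p} \<union> {(p, q). p \<in> I \<and> q \<in> L \<and> gidx q < gidx p}"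
    by auto
  show ?thesis
    unfolding reorder_sign_def eq
    by (subst card_Un_disjoint) (use assms in \<open>auto simp: power_add\<close>)
qed

instantiation grassmann :: (finite) real_algebra_1
begin

lift_definition zero_grassmann :: "'a grassmann" is "\<lambda>I. 0" .
lift_definition one_grassmann :: "'a grassmann" is "\<lambda>I. if I = {} then 1 else 0" .
lift_definition plus_grassmann :: "'a grassmann \<Rightarrow> 'a grassmann \<Rightarrow> 'a grassmann"
  is "\<lambda>f g I. f I + g I" .
lift_definition minus_grassmann :: "'a grassmann \<Rightarrow> 'a grassmann \<Rightarrow> 'a grassmann"
  is "\<lambda>f g I. f I - g I" .
lift_definition uminus_grassmann :: "'a grassmann \<Rightarrow> 'a grassmann"
  is "\<lambda>f I. - f I" .
lift_definition scaleR_grassmann :: "real \<Rightarrow> 'a grassmann \<Rightarrow> 'a grassmann"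
  is "\<lambda>r f I. r * f I" .
lift_definition times_grassmann :: "'a grassmann \<Rightarrow> 'a grassmann \<Rightarrow> 'a grassmann"
  is "\<lambda>f g K. \<Sum>I\<in>Pow K. reorder_sign I (K - I) * f I * g (K - I)" .

instance
proof
  fix a b c :: "'a grassmann" and r s :: real
  show "a * b * c = a * (b * c)"
  proof (transfer, rule ext)
    fix f g h :: "('a + 'a) set \<Rightarrow> real" and K :: "('a + 'a) set"
    have "(\<Sum>M\<in>Pow K. reorder_sign M (K - M) *
            (\<Sum>I\<in>Pow M. reorder_sign I (M - I) * f I * g (M - I)) * h (K - M)) =
          (\<Sum>(M, I)\<in>Sigma (Pow K) Pow. reorder_sign M (K - M) * reorder_sign I (M - I) *
             f I * g (M - I) * h (K - M))"
      by (subst sum.Sigma [symmetric])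
         (auto simp: sum_distrib_left sum_distrib_right mult_ac)
    also have "\<dots> = (\<Sum>(I, J)\<in>Sigma (Pow K) (\<lambda>I. Pow (K - I)).
             reorder_sign I (K - I) * reorder_sign J (K - I - J) * f I * g J * h (K - I - J))"
    proof (rule sum.reindex_bij_witness
        [where i = "\<lambda>(I, J). (I \<union> J, I)" and j = "\<lambda>(M, I). (I, M - I)"], goal_cases)
      case (5 x)
      then obtain M I where x: "x = (M, I)" and sub: "I \<subseteq> M" "M \<subseteq> K"
        by auto
      have M: "I \<union> (M - I) = M" and KI: "(M - I) \<union> (K - M) = K - I" and Kd: "K - I - (M - I) = K - M"
        using sub by auto
      have "reorder_sign M (K - M) = reorder_sign I (K - M) * reorder_sign (M - I) (K - M)"
        using reorder_sign_Un_left[of I "M - I" "K - M"] M by simp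
      moreover have "reorder_sign I (K - I) = reorder_sign I (M - I) * reorder_sign I (K - M)"
        using reorder_sign_Un_right[of "M - I" "K - M" I] KI by auto
      ultimately show ?case
        by (simp add: x Kd)
    qed auto
    also have "\<dots> = (\<Sum>I\<in>Pow K. reorder_sign I (K - I) * f I *
            (\<Sum>J\<in>Pow (K - I). reorder_sign J (K - I - J) * g J * h (K - I - J)))"
      by (subst sum.Sigma [symmetric])
         (auto simp: sum_distrib_left sum_distrib_right mult_ac)
    finally show "(\<Sum>M\<in>Pow K. reorder_sign M (K - M) *
            (\<Sum>I\<in>Pow M. reorder_sign I (M - I) * f I * g (M - I)) * h (K - M)) =
          (\<Sum>I\<in>Pow K. reorder_sign I (K - I) * f I *
            (\<Sum>J\<in>Pow (K - I). reorder_sign J (K - I - J) * g J * h (K - I - J)))" .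
  qed
  show "1 * a = a"
  proof (transfer, rule ext)
    fix f :: "('a + 'a) set \<Rightarrow> real" and K
    have "(\<Sum>I\<in>Pow K. reorder_sign I (K - I) * (if I = {} then 1 else 0) * f (K - I)) =
          (\<Sum>I\<in>Pow K. if I = {} then f K else 0)"
      by (rule sum.cong) auto
    then show "(\<Sum>I\<in>Pow K. reorder_sign I (K - I) * (if I = {} then 1 else 0) * f (K - I)) = f K"
      by simp
  qed
  show "a * 1 = a"
  proof (transfer, rule ext)
    fix f :: "('a + 'a) set \<Rightarrow> real" and K
    have "(\<Sum>I\<in>Pow K. reorder_sign I (K - I) * f I * (if K - I = {} then 1 else 0)) =
          (\<Sum>I\<in>Pow K. if I = K then f K else 0)"
      by (rule sum.cong) auto
    then show "(\<Sum>I\<in>Pow K. reorder_sign I (K - I) * f I * (if K - I = {} then 1 else 0)) = f K"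
      by simp
  qed
  show "(0 :: 'a grassmann) \<noteq> 1"
    by transfer (auto dest: fun_cong[where x = "{}"])
qed (transfer; force simp: algebra_simps sum.distrib sum_distrib_left)+

end

definition gen :: "'v + 'v \<Rightarrow> 'v::finite grassmann"
  where "gen p = Grassmann (\<lambda>I. if I = {p} then 1 else 0)"

abbreviation xi :: "'v \<Rightarrow> 'v::finite grassmann" where "xi i \<equiv> gen (Inl i)"
abbreviation eta :: "'v \<Rightarrow> 'v::finite grassmann" where "eta i \<equiv> gen (Inr i)"

abbreviation body :: "'v::finite grassmann \<Rightarrow> real" where "body f \<equiv> gcoeff f {}"

lemma gcoeff_gen_mult:
  "gcoeff (gen p * gen q) K = (if p \<noteq> q \<and> K = {p, q} then reorder_sign {p} {q} else 0)"
proof -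
  have "gcoeff (gen p * gen q) K =
      (\<Sum>I\<in>Pow K. if I = {p} then (if K - {p} = {q} then reorder_sign {p} {q} else 0) else 0)"
    unfolding times_grassmann.rep_eq gen_def
    by (rule sum.cong) (auto simp: Grassmann_inverse)
  also have "\<dots> = (if p \<in> K \<and> K - {p} = {q} then reorder_sign {p} {q} else 0)"
    by simp
  also have "p \<in> K \<and> K - {p} = {q} \<longleftrightarrow> p \<noteq> q \<and> K = {p, q}"
    by auto
  finally show ?thesis .
qed

lemma gen_anticommute: "gen p * gen q = - (gen q * gen p)"
proof (cases "p = q")
  case False
  have "inj (gidx :: 'a + 'a \<Rightarrow> nat)"
    unfolding gidx_def by (simp add: inj_on_to_nat_on)
  with False have "gidx p \<noteq> gidx q"
    by (auto dest: injD)
  moreover have "{(p', q'). p' \<in> {a} \<and> q' \<in> {b} \<and> gidx q' < gidx p'} =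
      (if gidx b < gidx a then {(a, b)} else {})" for a b :: "'a + 'a"
    by auto
  ultimately have "reorder_sign {p} {q} = - reorder_sign {q} {p}"
    by (simp add: reorder_sign_def)
  then show ?thesis
    by (intro iffD1[OF gcoeff_inject] ext)
       (auto simp: gcoeff_gen_mult uminus_grassmann.rep_eq insert_commute)
qed (intro iffD1[OF gcoeff_inject] ext, auto simp: gcoeff_gen_mult uminus_grassmann.rep_eq)

text \<open>Left derivative: \<open>e\<^bsub>J \<union> {p}\<^esub> = reorder_sign {p} J \<cdot> gen p \<cdot> e\<^sub>J\<close> for \<open>p \<notin> J\<close>.\<close>

definition left_deriv :: "'v + 'v \<Rightarrow> 'v::finite grassmann \<Rightarrow> 'v grassmann"
  where "left_deriv p f =
    Grassmann (\<lambda>J. if p \<in> J then 0 else reorder_sign {p} J * gcoeff f (insert p J))"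

text \<open>
  Finite families are enumerated in a fixed order. All products and iterated integrals below
  run over commuting (even) factors or pairs \<open>d\<xi>\<^sub>i d\<eta>\<^sub>i\<close>, so the order is immaterial.
\<close>

definition listing :: "'v set \<Rightarrow> 'v::finite list"
  where "listing S = map (from_nat_into S) [0..<card S]"

definition oprod :: "'v::finite set \<Rightarrow> ('v \<Rightarrow> 'a::monoid_mult) \<Rightarrow> 'a"
  where "oprod S f = prod_list (map f (listing S))"

lemma listing: "distinct (listing S)" "set (listing S) = S"
proof -
  have "bij_betw (from_nat_into S) {..<card S} S"
    by (simp add: bij_betw_from_nat_into_finite)
  then show "distinct (listing S)" "set (listing S) = S"
    by (auto simp: listing_def distinct_map bij_betw_def lessThan_atLeast0)
qed

lemma oprod_commutative:
  fixes f :: "'v::finite \<Rightarrow> 'a::comm_monoid_mult"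
  shows "oprod S f = prod f S"
  using prod.distinct_set_conv_list[of "listing S" f] by (simp add: oprod_def listing)

text \<open>\<open>\<integral> \<Prod>\<^bsub>i \<in> S\<^esub> d\<xi>\<^sub>i d\<eta>\<^sub>i f\<close>, where \<open>\<integral> d\<xi>\<^sub>i d\<eta>\<^sub>i f = \<partial>\<^bsub>\<xi>\<^sub>i\<^esub> (\<partial>\<^bsub>\<eta>\<^sub>i\<^esub> f)\<close>.\<close>

definition berezin :: "'v set \<Rightarrow> 'v::finite grassmann \<Rightarrow> 'v grassmann"
  where "berezin S f = fold (\<lambda>i h. left_deriv (Inl i) (left_deriv (Inr i) h)) (listing S) f"

text \<open>The substitution \<open>\<xi>\<^sub>\<delta> = \<eta>\<^sub>\<delta> = 0\<close>.\<close>

definition pin_odd :: "'v \<Rightarrow> 'v::finite grassmann \<Rightarrow> 'v grassmann"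
  where "pin_odd \<delta> f = Grassmann (\<lambda>I. if Inl \<delta> \<in> I \<or> Inr \<delta> \<in> I then 0 else gcoeff f I)"

text \<open>
  A smooth function of an even element, by Taylor expansion in the nilpotent part; powers of the
  nilpotent part above the number \<open>2 |U|\<close> of generators vanish.
\<close>

definition gtaylor :: "(real \<Rightarrow> real) \<Rightarrow> 'v::finite grassmann \<Rightarrow> 'v grassmann"
  where "gtaylor f a = (\<Sum>k\<le>2 * CARD('v).
    ((deriv ^^ k) f (body a) / fact k) *\<^sub>R (a - of_real (body a)) ^ k)"

definition gintegral :: "'a measure \<Rightarrow> ('a \<Rightarrow> 'v::finite grassmann) \<Rightarrow> 'v grassmann"
  where "gintegral M f = Grassmann (\<lambda>I. \<integral>t. gcoeff (f t) I \<partial>M)"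


section \<open>Weighted graphs and the mixing measure\<close>

definition connected_weighted_graph :: "('v::finite \<Rightarrow> 'v \<Rightarrow> real) \<Rightarrow> bool"
  where "connected_weighted_graph w \<longleftrightarrow>
    (\<forall>i j. w i j \<ge> 0) \<and> (\<forall>i j. w i j = w j i) \<and> (\<forall>i. w i i = 0) \<and>
    (\<forall>i j. (i, j) \<in> {(k, l). w k l > 0}\<^sup>*)"

text \<open>Each undirected edge is represented once, oriented along a fixed numbering of the vertices.\<close>

definition edges :: "('v::finite \<Rightarrow> 'v \<Rightarrow> real) \<Rightarrow> ('v \<times> 'v) set"
  where "edges w = {(i, j). w i j > 0 \<and> to_nat_on UNIV i < to_nat_on UNIV j}"

definition adjacent_in :: "('v \<times> 'v) set \<Rightarrow> 'v \<Rightarrow> 'v \<Rightarrow> bool"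
  where "adjacent_in T i j \<longleftrightarrow> (i, j) \<in> T \<or> (j, i) \<in> T"

definition has_cycle :: "('v \<times> 'v) set \<Rightarrow> bool"
  where "has_cycle T \<longleftrightarrow> (\<exists>p. length p \<ge> 3 \<and> distinct p \<and>
    (\<forall>k<length p. adjacent_in T (p ! k) (p ! ((k + 1) mod length p))))"

definition spanning_trees :: "('v::finite \<Rightarrow> 'v \<Rightarrow> real) \<Rightarrow> ('v \<times> 'v) set set"
  where "spanning_trees w = {T. T \<subseteq> edges w \<and>
    (\<forall>i j. (i, j) \<in> {(k, l). adjacent_in T k l}\<^sup>*) \<and> \<not> has_cycle T}"

definition tree_sum :: "('v::finite \<Rightarrow> 'v \<Rightarrow> real) \<Rightarrow> real ^ 'v \<Rightarrow> real"
  where "tree_sum w u = (\<Sum>T\<in>spanning_trees w. \<Prod>(i, j)\<in>T. w i j * exp (u $ i + u $ j))"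

text \<open>Lebesgue measure in the coordinates other than \<open>k\<close>, with coordinate \<open>k\<close> fixed to \<open>c\<close>.\<close>

definition pinned_lebesgue :: "'v::finite \<Rightarrow> real \<Rightarrow> (real ^ 'v) measure"
  where "pinned_lebesgue k c =
    distr (Pi\<^sub>M (UNIV - {k}) (\<lambda>_. lborel)) borel (\<lambda>f. \<chi> i. if i = k then c else f i)"

text \<open>
  The density of the mixing measure, for parameters \<open>\<theta>\<^sub>i\<close> in a real algebra with exponential
  function \<open>ex\<close>: it is used for real \<open>\<theta>\<close> and for even Grassmann elements. In the latter case
  \<open>ex\<close> is the Taylor extension of the exponential function, and the dependence on \<open>\<theta>\<close> is
  otherwise polynomial.
\<close>

definition mixing_density ::
    "('a \<Rightarrow> 'a) \<Rightarrow> ('v::finite \<Rightarrow> 'v \<Rightarrow> real) \<Rightarrow> 'v \<Rightarrow> ('v \<Rightarrow> 'a::real_algebra_1) \<Rightarrow> real ^ 'v \<Rightarrow> 'a"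
  where "mixing_density ex w i0 \<theta> u =
    ex (- (1 / 2) *\<^sub>R (\<Sum>(i, j)\<in>edges w. w i j *\<^sub>R
          (exp (u $ i - u $ j) *\<^sub>R (\<theta> j)\<^sup>2 + exp (u $ j - u $ i) *\<^sub>R (\<theta> i)\<^sup>2 - 2 *\<^sub>R (\<theta> i * \<theta> j))))
    * of_real (sqrt (tree_sum w u))
    * oprod (UNIV - {i0}) (\<lambda>i. (exp (- u $ i) / sqrt (2 * pi)) *\<^sub>R \<theta> i)"

definition mixing_measure ::
    "('v::finite \<Rightarrow> 'v \<Rightarrow> real) \<Rightarrow> 'v \<Rightarrow> ('v \<Rightarrow> real) \<Rightarrow> (real ^ 'v) measure"
  where "mixing_measure w i0 \<theta> =
    density (pinned_lebesgue i0 0) (\<lambda>u. ennreal (mixing_density exp w i0 \<theta> u))"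

definition mixing_gintegral ::
    "('v::finite \<Rightarrow> 'v \<Rightarrow> real) \<Rightarrow> 'v \<Rightarrow> ('v \<Rightarrow> 'v grassmann) \<Rightarrow> (real ^ 'v \<Rightarrow> 'v grassmann) \<Rightarrow> 'v grassmann"
  where "mixing_gintegral w i0 \<theta> f =
    gintegral (pinned_lebesgue i0 0) (\<lambda>u. f u * mixing_density (gtaylor exp) w i0 \<theta> u)"


section \<open>The \<open>H\<^bsup>2|2\<^esup>\<close> model and the supersymmetric free field\<close>

definition z_field :: "real ^ 'v \<Rightarrow> real ^ 'v \<Rightarrow> 'v \<Rightarrow> 'v::finite grassmann"
  where "z_field x y i = gtaylor sqrt (of_real (1 + (x $ i)\<^sup>2 + (y $ i)\<^sup>2) + 2 * xi i * eta i)"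

definition X_dot :: "real ^ 'v \<Rightarrow> real ^ 'v \<Rightarrow> 'v \<Rightarrow> 'v \<Rightarrow> 'v::finite grassmann"
  where "X_dot x y i j = of_real (x $ i * x $ j + y $ i * y $ j) + xi i * eta j + xi j * eta i"

definition v_dot :: "real ^ 'v \<Rightarrow> real ^ 'v \<Rightarrow> 'v \<Rightarrow> 'v \<Rightarrow> 'v::finite grassmann"
  where "v_dot x y i j = of_real (x $ i * x $ j + y $ i * y $ j) - z_field x y i * z_field x y j
    + xi i * eta j + xi j * eta i"

text \<open>
  \<open>\<integral> F \<Prod>\<^bsub>i \<noteq> \<delta>\<^esub> dx\<^sub>i dy\<^sub>i d\<xi>\<^sub>i d\<eta>\<^sub>i\<close> at \<open>x\<^sub>\<delta> = sinh s\<close>, \<open>y\<^sub>\<delta> = 0\<close>, \<open>\<xi>\<^sub>\<delta> = \<eta>\<^sub>\<delta> = 0\<close>.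
  The remaining coordinate of \<open>v\<^sub>\<delta> = \<theta>\<^sub>s(0)\<close> is then \<open>z\<^sub>\<delta> = cosh s\<close>.
\<close>

definition super_integral ::
    "'v::finite \<Rightarrow> real \<Rightarrow> (real ^ 'v \<Rightarrow> real ^ 'v \<Rightarrow> 'v grassmann) \<Rightarrow> real"
  where "super_integral \<delta> s F =
    (\<integral>(x, y). body (berezin (UNIV - {\<delta>}) (pin_odd \<delta> (F x y)))
       \<partial>(pinned_lebesgue \<delta> (sinh s) \<Otimes>\<^sub>M pinned_lebesgue \<delta> 0))"

definition H22_expectation ::
    "('v::finite \<Rightarrow> 'v \<Rightarrow> real) \<Rightarrow> 'v \<Rightarrow> real \<Rightarrow> (real ^ 'v \<Rightarrow> real ^ 'v \<Rightarrow> 'v grassmann) \<Rightarrow> real"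
  where "H22_expectation w \<delta> s F = super_integral \<delta> s (\<lambda>x y.
    F x y * gtaylor exp (\<Sum>(i, j)\<in>edges w. w i j *\<^sub>R (v_dot x y i j + 1))
      * oprod (UNIV - {\<delta>}) (\<lambda>i. (1 / (2 * pi)) *\<^sub>R gtaylor inverse (z_field x y i)))"

definition A_matrix :: "('v::finite \<Rightarrow> 'v \<Rightarrow> real) \<Rightarrow> real ^ 'v \<Rightarrow> real ^ 'v ^ 'v"
  where "A_matrix w u =
    (\<chi> i j. if i = j then (\<Sum>k\<in>UNIV - {i}. w i k * exp (u $ k - u $ i)) else - w i j)"

definition free_expectation ::
    "real ^ 'v ^ 'v \<Rightarrow> 'v::finite \<Rightarrow> real \<Rightarrow> (real ^ 'v \<Rightarrow> real ^ 'v \<Rightarrow> 'v grassmann) \<Rightarrow> real"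
  where "free_expectation A \<delta> s F = super_integral \<delta> s (\<lambda>x y.
    F x y * gtaylor exp (- (1 / 2) *\<^sub>R (\<Sum>i\<in>UNIV. \<Sum>j\<in>UNIV. (A $ i $ j) *\<^sub>R X_dot x y i j))
      * of_real (\<Prod>i\<in>UNIV - {\<delta>}. 1 / (2 * pi)))"


section \<open>Test functions\<close>

fun C_k :: "nat \<Rightarrow> ('a::euclidean_space \<Rightarrow> real) \<Rightarrow> bool"
  where
    "C_k 0 f \<longleftrightarrow> continuous_on UNIV f"
  | "C_k (Suc k) f \<longleftrightarrow> (\<forall>p. f differentiable (at p)) \<and>
       (\<forall>v. C_k k (\<lambda>p. frechet_derivative f (at p) v))"

definition smooth :: "('a::euclidean_space \<Rightarrow> real) \<Rightarrow> bool"
  where "smooth f \<longleftrightarrow> (\<forall>k. C_k k f)"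

definition rapid_decay :: "('a::real_normed_vector \<Rightarrow> real) \<Rightarrow> bool"
  where "rapid_decay f \<longleftrightarrow> (\<forall>N. \<exists>C. \<forall>p. \<bar>f p\<bar> * (1 + norm p) ^ N \<le> C)"

text \<open>
  The functions \<open>g\<close> of \<open>(x, y, \<xi>, \<eta>, u)\<close>: all coefficients, as functions of all real variables
  \<open>(x, y, u)\<close>, are smooth, bounded and of rapid decay. Decay of derivatives is not required.
\<close>

definition test_function :: "(real ^ 'v \<Rightarrow> real ^ 'v \<Rightarrow> real ^ 'v \<Rightarrow> 'v::finite grassmann) \<Rightarrow> bool"
  where "test_function g \<longleftrightarrow> (\<forall>I.
    let c = (\<lambda>(x, y, u). gcoeff (g x y u) I)
    in smooth c \<and> bounded (range c) \<and> rapid_decay c)"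

end

theory Submission
  imports Defs "HOL-Probability.Sinc_Integral"
begin

text \<open>
  The two sides agree because their integrands agree for every \<open>(x, y, u)\<close>, as elements of the
  Grassmann algebra; what remains is to exchange the integral over \<open>u\<close> with the superintegral.

  Pointwise equality. The factors \<open>z\<^sub>i\<close> (\<open>i \<noteq> a\<close>) of the mixing density, together with the weight
  \<open>z\<^sub>a / z\<^sub>\<delta>\<close>, cancel the factors \<open>1 / z\<^sub>i\<close> (\<open>i \<noteq> \<delta>\<close>) of the \<open>H\<^bsup>2|2\<^esup>\<close> measure. In the exponent, the terms
  \<open>w\<^sub>i\<^sub>j z\<^sub>i z\<^sub>j\<close> of the mixing density cancel those of \<open>w\<^sub>i\<^sub>j (v\<^sub>i \<cdot> v\<^sub>j + 1)\<close>, and substituting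
  \<open>z\<^sub>i\<^sup>2 = 1 + X\<^sub>i \<cdot> X\<^sub>i\<close> leaves \<open>- 1/2 \<Sum>\<^bsub>i,j\<^esub> A\<^sub>i\<^sub>j X\<^sub>i \<cdot> X\<^sub>j\<close> plus the real exponent of the mixing density at
  \<open>\<theta> = 1\<close>. These computations (\<open>exponent_identity\<close>, \<open>integrand_identity\<close>) take place among central
  elements, and use that the Taylor extension of \<open>exp\<close> is multiplicative on them (\<open>gtaylor_exp_add\<close>).
  The same identity read backwards shows that the mixing density in the variables \<open>z\<close> is an
  invertible central factor, depending on \<open>x\<close> and \<open>y\<close> only, times the weighted Gaussian. So the
  integral over \<open>u\<close> of the left-hand side converges whenever the one of the right-hand side does
  (\<open>H22_mixing_integrand\<close>).

  Exchange of the integrals. The nilpotent part of \<open>- 1/2 \<Sum>\<^bsub>i,j\<^esub> A\<^sub>i\<^sub>j X\<^sub>i \<cdot> X\<^sub>j\<close> does not depend on \<open>x\<close> and \<open>y\<close>,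
  and its real part is nonpositive. Hence each coefficient of the integrand is a sum of coefficients of \<open>g\<close> times
  bounded functions times functions of \<open>u\<close> of at most exponential growth times \<open>exp (- cosh_energy w u)\<close>.
  On a connected graph the last factor beats exponential growth (\<open>exp_energy_bound\<close>), and rapid decay of \<open>g\<close>
  supplies an integrable majorant in all variables (\<open>weighted_free_integrand_bound\<close>), so that Fubini's
  theorem applies to each coefficient.
\<close>

section \<open>Coefficients of Grassmann elements\<close>

lemma gcoeff_zero [simp]: "gcoeff 0 I = 0"
  by (simp add: zero_grassmann.rep_eq)

lemma gcoeff_one: "gcoeff 1 I = (if I = {} then 1 else 0)"
  by (simp add: one_grassmann.rep_eq)

lemma gcoeff_add [simp]: "gcoeff (f + g) I = gcoeff f I + gcoeff g I"
  by (simp add: plus_grassmann.rep_eq)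

lemma gcoeff_diff [simp]: "gcoeff (f - g) I = gcoeff f I - gcoeff g I"
  by (simp add: minus_grassmann.rep_eq)

lemma gcoeff_uminus [simp]: "gcoeff (- f) I = - gcoeff f I"
  by (simp add: uminus_grassmann.rep_eq)

lemma gcoeff_scaleR [simp]: "gcoeff (r *\<^sub>R f) I = r * gcoeff f I"
  by (simp add: scaleR_grassmann.rep_eq)

lemma gcoeff_of_real: "gcoeff (of_real r) I = (if I = {} then r else 0)"
  by (simp add: of_real_def gcoeff_one)

lemma gcoeff_sum [simp]: "gcoeff (sum f S) I = (\<Sum>s\<in>S. gcoeff (f s) I)"
  by (induction S rule: infinite_finite_induct) auto

lemma gcoeff_mult:
  "gcoeff (f * g) K = (\<Sum>I\<in>Pow K. reorder_sign I (K - I) * gcoeff f I * gcoeff g (K - I))"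
  unfolding times_grassmann.rep_eq ..

lemma gcoeff_Grassmann [simp]: "gcoeff (Grassmann f) = f"
  by (simp add: Grassmann_inverse)

lemma grassmann_eqI: "(\<And>I. gcoeff f I = gcoeff g I) \<Longrightarrow> f = g"
  by (simp add: gcoeff_inject[symmetric] ext)

lemma body_mult [simp]: "body (f * g) = body f * body g"
  by (simp add: gcoeff_mult)

section \<open>Even elements are central\<close>

text \<open>
  Elements that commute with the whole algebra. This is implied by evenness and is all that is used of
  even elements; its closure properties hold in any algebra.
\<close>

definition central :: "'v::finite grassmann \<Rightarrow> bool"
  where "central c \<longleftrightarrow> (\<forall>f. c * f = f * c)"

lemma centralD: "central c \<Longrightarrow> c * f = f * c"
  by (simp add: central_def)

lemma central_of_real [simp, intro]: "central (of_real r)"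
  by (simp add: central_def of_real_def)

lemma central_scaleR [intro]: "central c \<Longrightarrow> central (r *\<^sub>R c)"
  by (simp add: central_def)

lemma central_zero [simp, intro]: "central 0"
  and central_one [simp, intro]: "central 1"
  by (simp_all add: central_def)

lemma central_add [intro]: "central c \<Longrightarrow> central d \<Longrightarrow> central (c + d)"
  by (simp add: central_def algebra_simps)

lemma central_diff [intro]: "central c \<Longrightarrow> central d \<Longrightarrow> central (c - d)"
  by (simp add: central_def algebra_simps)

lemma central_mult [intro]:
  assumes c: "central c" and d: "central d"
  shows "central (c * d)"
  unfolding central_def
proof
  fix f
  have "c * d * f = c * f * d"
    by (simp only: mult.assoc centralD[OF d])
  then show "c * d * f = f * (c * d)"
    by (simp only: mult.assoc centralD[OF c, of f])
qed

lemma central_power [intro]: "central c \<Longrightarrow> central (c ^ n)"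
  by (induction n) auto

lemma central_sum [intro]: "(\<And>s. s \<in> S \<Longrightarrow> central (f s)) \<Longrightarrow> central (sum f S)"
  by (induction S rule: infinite_finite_induct) auto

lemma central_gtaylor [intro]: "central a \<Longrightarrow> central (gtaylor f a)"
  unfolding gtaylor_def by (intro central_sum central_scaleR central_power central_diff) auto

text \<open>Moving \<open>e\<^sub>J\<close> past \<open>e\<^sub>I\<close> takes \<open>|I| |J|\<close> transpositions.\<close>

lemma reorder_sign_swap:
  assumes "I \<inter> J = {}"
  shows "reorder_sign I J = (-1) ^ (card I * card J) * reorder_sign J I"
proof -
  let ?A = "{(p, q). p \<in> I \<and> q \<in> J \<and> gidx q < gidx p}"
  let ?B = "{(p, q). p \<in> I \<and> q \<in> J \<and> gidx p < gidx q}"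
  have inj: "gidx p = gidx q \<longleftrightarrow> p = q" for p q :: "'a + 'a"
    unfolding gidx_def by (simp add: inj_on_eq_iff[OF inj_on_to_nat_on])
  have "card {(p, q). p \<in> J \<and> q \<in> I \<and> gidx q < gidx p} = card ?B"
    by (rule bij_betw_same_card[where f = prod.swap])
       (auto simp: bij_betw_def inj_on_def image_iff)
  then have B: "reorder_sign J I = (-1) ^ card ?B"
    by (simp add: reorder_sign_def)
  have "gidx p < gidx q \<or> gidx q < gidx p" if "p \<in> I" "q \<in> J" for p q
    using assms that inj[of p q] by (metis IntI empty_iff linorder_less_linear)
  then have "I \<times> J = ?A \<union> ?B"
    by auto
  then have "card (I \<times> J) = card (?A \<union> ?B)"
    by (rule arg_cong)
  also have "\<dots> = card ?A + card ?B"
    by (rule card_Un_disjoint) auto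
  finally have "(-1::real) ^ (card I * card J) = (-1) ^ card ?A * (-1) ^ card ?B"
    by (simp add: card_cartesian_product power_add)
  moreover have "(-1 :: real) ^ card ?B * (-1) ^ card ?B = 1"
    by (simp flip: power_mult_distrib)
  moreover have "reorder_sign I J = (-1) ^ card ?A"
    by (simp only: reorder_sign_def)
  ultimately show ?thesis
    unfolding B by (simp only: mult.assoc mult_1_right)
qed

text \<open>An element without odd coefficients commutes with everything.\<close>

lemma central_if_even:
  fixes c :: "'v::finite grassmann"
  assumes even: "\<And>I. odd (card I) \<Longrightarrow> gcoeff c I = 0"
  shows "central c"
  unfolding central_def
proof (intro allI grassmann_eqI)
  fix f :: "'v grassmann" and K
  have "gcoeff (c * f) K = (\<Sum>I\<in>Pow K. reorder_sign (K - I) I * gcoeff f (K - I) * gcoeff c I)"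
    unfolding gcoeff_mult
  proof (rule sum.cong[OF refl])
    fix I
    show "reorder_sign I (K - I) * gcoeff c I * gcoeff f (K - I)
        = reorder_sign (K - I) I * gcoeff f (K - I) * gcoeff c I"
    proof (cases "odd (card I)")
      case False
      then have "(-1 :: real) ^ (card I * card (K - I)) = 1"
        by simp
      then have "reorder_sign I (K - I) = reorder_sign (K - I) I"
        by (subst reorder_sign_swap) auto
      then show ?thesis by (simp only: mult_ac)
    qed (simp add: even)
  qed
  also have "\<dots> = gcoeff (f * c) K"
    unfolding gcoeff_mult
  proof (rule sum.reindex_bij_witness[where i = "\<lambda>I. K - I" and j = "\<lambda>I. K - I"])
    fix I assume "I \<in> Pow K"
    then have "K - (K - I) = I" by auto
    then show "K - (K - I) = I"
      and "reorder_sign (K - I) (K - (K - I)) * gcoeff f (K - I) * gcoeff c (K - (K - I))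
        = reorder_sign (K - I) I * gcoeff f (K - I) * gcoeff c I"
      by simp_all
  qed (auto simp: double_diff)
  finally show "gcoeff (c * f) K = gcoeff (f * c) K" .
qed

lemma central_gen_mult [intro]: "central (gen p * gen q)"
  by (rule central_if_even) (auto simp: gcoeff_gen_mult)

section \<open>Taylor extension of functions to even elements\<close>

text \<open>Every monomial in \<open>f\<close> has degree at least \<open>k\<close>.\<close>

definition order_ge :: "nat \<Rightarrow> 'v::finite grassmann \<Rightarrow> bool"
  where "order_ge k f \<longleftrightarrow> (\<forall>I. card I < k \<longrightarrow> gcoeff f I = 0)"

lemma order_ge_mult:
  assumes "order_ge k f" "order_ge l g"
  shows "order_ge (k + l) (f * g)"
  unfolding order_ge_def
proof (intro allI impI)
  fix K :: "('a + 'a) set" assume K: "card K < k + l"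
  have "gcoeff f I = 0 \<or> gcoeff g (K - I) = 0" if "I \<subseteq> K" for I
  proof (cases "card I < k")
    case False
    then have "card (K - I) < l"
      using K that card_mono[of K I] by (subst card_Diff_subset) auto
    then show ?thesis
      using assms by (auto simp: order_ge_def)
  qed (use assms in \<open>auto simp: order_ge_def\<close>)
  then show "gcoeff (f * g) K = 0"
    unfolding gcoeff_mult by (intro sum.neutral) auto
qed

lemma order_ge_power: "order_ge 1 f \<Longrightarrow> order_ge k (f ^ k)"
proof (induction k)
  case (Suc k)
  then show ?case using order_ge_mult[of 1 f k "f ^ k"] by simp
qed (simp add: order_ge_def)

lemma order_ge_eq_0:
  fixes f :: "'v::finite grassmann"
  assumes "order_ge k f" "k > 2 * CARD('v)"
  shows "f = 0"
proof (rule grassmann_eqI)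
  fix I :: "('v + 'v) set"
  have "card I \<le> CARD('v + 'v)"
    by (rule card_mono) auto
  also have "CARD('v + 'v) = 2 * CARD('v)"
    by (simp add: card_UNIV_sum)
  finally show "gcoeff f I = gcoeff 0 I"
    using assms by (auto simp: order_ge_def)
qed

text \<open>The exponential series of a nilpotent element.\<close>

definition nilexp :: "'v::finite grassmann \<Rightarrow> 'v grassmann"
  where "nilexp N = (\<Sum>k\<le>2 * CARD('v). (1 / fact k) *\<^sub>R N ^ k)"

lemma deriv_exp_iterate: "(deriv ^^ k) exp = (exp :: real \<Rightarrow> real)"
proof (induction k)
  case (Suc k)
  have "deriv exp = (exp :: real \<Rightarrow> real)"
    by (rule ext) (rule DERIV_imp_deriv, rule DERIV_exp)
  with Suc show ?case by simp
qed simp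

lemma gtaylor_exp: "gtaylor exp a = exp (body a) *\<^sub>R nilexp (a - of_real (body a))"
  unfolding gtaylor_def nilexp_def deriv_exp_iterate scaleR_sum_right scaleR_scaleR
  by (rule sum.cong) (auto simp only: times_divide_eq_right mult_1_right)

text \<open>
  The binomial theorem; the Cauchy product contains additional terms \<open>M\<^sup>i N\<^sup>j\<close> with \<open>i + j\<close> greater
  than the number of generators, which vanish.
\<close>

lemma nilexp_add:
  fixes M N :: "'v::finite grassmann"
  assumes "central M" "body M = 0" "body N = 0"
  shows "nilexp (M + N) = nilexp M * nilexp N"
proof -
  let ?n = "2 * CARD('v)"
  \<comment> \<open>The algebra is not commutative, but \<open>M\<close> commutes with \<open>N\<close> because it is central.\<close>
  have binom: "(M + N) ^ k = (\<Sum>i\<le>k. of_nat (k choose i) *\<^sub>R (M ^ i * N ^ (k - i)))" for k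
  proof (induction k)
    case (Suc k)
    have comm: "N * M ^ i = M ^ i * N" for i
      using central_power[OF assms(1)] by (simp add: centralD)
    define f where "f i = M ^ i * N ^ (Suc k - i)" for i
    have fS: "M * (M ^ i * N ^ (k - i)) = f (Suc i)" for i
      by (simp add: f_def mult.assoc)
    have f: "N * (M ^ i * N ^ (k - i)) = f i" if "i \<le> k" for i
      using that by (simp add: f_def Suc_diff_le mult.assoc[symmetric] comm)
    have "(M + N) ^ Suc k = (\<Sum>i\<le>k. of_nat (k choose i) *\<^sub>R f (Suc i))
        + (\<Sum>i\<le>k. of_nat (k choose i) *\<^sub>R f i)"
      by (simp add: Suc distrib_right sum_distrib_left fS f scaleR_add_right sum.distrib)
    also have "(\<Sum>i\<le>k. of_nat (k choose i) *\<^sub>R f i) = f 0 + (\<Sum>i\<le>k. of_nat (k choose Suc i) *\<^sub>R f (Suc i))"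
      using sum.atMost_Suc_shift[of "\<lambda>i. of_nat (k choose i) *\<^sub>R f i" k] by (simp add: binomial_eq_0)
    finally show ?case
      by (subst sum.atMost_Suc_shift)
         (simp add: f_def sum.distrib scaleR_left_distrib)
  qed simp
  have "nilexp (M + N) = (\<Sum>k\<le>?n. \<Sum>i\<le>k. ((1 / fact i) *\<^sub>R M ^ i) * ((1 / fact (k - i)) *\<^sub>R N ^ (k - i)))"
    unfolding nilexp_def binom scaleR_sum_right
    by (intro sum.cong refl) (simp add: binomial_fact field_simps)
  also have "\<dots> = (\<Sum>(i, j)\<in>{(i, j). i + j \<le> ?n}. ((1 / fact i) *\<^sub>R M ^ i) * ((1 / fact j) *\<^sub>R N ^ j))"
    by (rule sum.triangle_reindex_eq[symmetric])
  also have "\<dots> = (\<Sum>(i, j)\<in>{..?n} \<times> {..?n}. ((1 / fact i) *\<^sub>R M ^ i) * ((1 / fact j) *\<^sub>R N ^ j))"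
  proof (rule sum.mono_neutral_left)
    have "M ^ i * N ^ j = 0" if "i + j > ?n" for i j
      using assms that by (intro order_ge_eq_0[of "i + j"] order_ge_mult order_ge_power)
        (auto simp: order_ge_def)
    then have "M ^ i * N ^ j = 0" if "\<not> i + j \<le> ?n" for i j
      using that by (metis not_le)
    then show "\<forall>p\<in>{..?n} \<times> {..?n} - {(i, j). i + j \<le> ?n}.
        (case p of (i, j) \<Rightarrow> ((1 / fact i) *\<^sub>R M ^ i) * ((1 / fact j) *\<^sub>R N ^ j)) = 0"
      by clarsimp blast
  qed auto
  also have "\<dots> = nilexp M * nilexp N"
    unfolding nilexp_def sum_product sum.cartesian_product ..
  finally show ?thesis .
qed

lemma gtaylor_exp_add:
  assumes "central a"
  shows "gtaylor exp (a + b) = gtaylor exp a * gtaylor exp b"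
proof -
  have "a + b - of_real (body (a + b)) = (a - of_real (body a)) + (b - of_real (body b))"
    by simp
  then show ?thesis
    unfolding gtaylor_exp using assms
    by (simp only: , subst nilexp_add) (auto simp: gcoeff_of_real exp_add)
qed

lemma nilexp_0 [simp]: "nilexp 0 = 1"
proof -
  have "(1 / fact k) *\<^sub>R (0 :: 'a grassmann) ^ k = (if k = 0 then 1 else 0)" for k
    by (cases k) auto
  then show ?thesis by (simp add: nilexp_def)
qed

lemma gtaylor_exp_of_real: "gtaylor exp (of_real r) = of_real (exp r)"
  by (simp add: gtaylor_exp gcoeff_of_real) (simp add: of_real_def)

text \<open>If the nilpotent part has square zero, the Taylor expansion stops after the linear term.\<close>

lemma gtaylor_square_zero:
  fixes N :: "'v::finite grassmann"
  assumes "N * N = 0" "body N = 0"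
  shows "gtaylor f (of_real r + N) = of_real (f r) + deriv f r *\<^sub>R N"
proof -
  have "CARD('v) > 0" by (simp add: card_gt_0_iff)
  then have sub: "{..1} \<subseteq> {..2 * CARD('v)}"
    by auto
  have N: "N ^ k = 0" if "k \<ge> 2" for k
  proof -
    have "N ^ k = N ^ 2 * N ^ (k - 2)"
      using that by (metis le_add_diff_inverse power_add)
    then show ?thesis by (simp add: power2_eq_square assms)
  qed
  have "gtaylor f (of_real r + N) = (\<Sum>k\<le>2 * CARD('v). ((deriv ^^ k) f r / fact k) *\<^sub>R N ^ k)"
    by (simp add: gtaylor_def gcoeff_of_real assms)
  also have "\<dots> = (\<Sum>k\<le>1. ((deriv ^^ k) f r / fact k) *\<^sub>R N ^ k)"
    by (intro sum.mono_neutral_right sub) (auto simp: N)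
  also have "\<dots> = of_real (f r) + deriv f r *\<^sub>R N"
    by (simp add: of_real_def)
  finally show ?thesis .
qed


section \<open>Ordered products of central factors\<close>

lemma prod_list_central_remove1:
  fixes f :: "'a \<Rightarrow> 'v::finite grassmann"
  assumes central: "\<And>y. central (f y)" and "x \<in> set ys"
  shows "prod_list (map f ys) = f x * prod_list (map f (remove1 x ys))"
  using assms(2)
proof (induction ys)
  case (Cons y ys)
  show ?case
  proof (cases "x = y")
    case False
    then have "prod_list (map f (y # ys)) = f y * f x * prod_list (map f (remove1 x ys))"
      using Cons by (simp add: mult.assoc)
    also have "f y * f x = f x * f y"
      using central by (rule centralD)
    finally show ?thesis using False by (simp add: mult.assoc)
  qed simp
qed simp

lemma prod_list_central_cong_set:
  fixes f :: "'a \<Rightarrow> 'v::finite grassmann"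
  assumes central: "\<And>y. central (f y)"
  shows "distinct xs \<Longrightarrow> distinct ys \<Longrightarrow> set xs = set ys \<Longrightarrow> prod_list (map f xs) = prod_list (map f ys)"
proof (induction xs arbitrary: ys)
  case (Cons x xs)
  then have "set xs = set (remove1 x ys)"
    by (auto simp: set_remove1_eq)
  with Cons have "prod_list (map f xs) = prod_list (map f (remove1 x ys))"
    by (intro Cons.IH) (auto simp: distinct_remove1)
  moreover have "x \<in> set ys"
    using Cons.prems(3) by auto
  ultimately show ?case
    by (simp add: prod_list_central_remove1[OF central])
qed simp

lemma oprod_remove:
  fixes f :: "'v::finite \<Rightarrow> 'v grassmann"
  assumes central: "\<And>i. central (f i)" and "a \<in> S"
  shows "f a * oprod (S - {a}) f = oprod S f"
proof -
  have "oprod S f = f a * prod_list (map f (remove1 a (listing S)))"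
    unfolding oprod_def using assms by (intro prod_list_central_remove1) (auto simp: listing)
  also have "prod_list (map f (remove1 a (listing S))) = oprod (S - {a}) f"
    unfolding oprod_def
    by (intro prod_list_central_cong_set central) (auto simp: listing distinct_remove1 set_remove1_eq)
  finally show ?thesis ..
qed

lemma oprod_scaleR:
  fixes f :: "'v::finite \<Rightarrow> 'a::real_algebra_1"
  shows "oprod S (\<lambda>i. k i *\<^sub>R f i) = prod k S *\<^sub>R oprod S f"
proof -
  have "prod_list (map (\<lambda>i. k i *\<^sub>R f i) xs) = prod_list (map k xs) *\<^sub>R prod_list (map f xs)" for xs
    by (induction xs) auto
  then show ?thesis
    by (simp add: oprod_commutative[of S k, symmetric]) (simp add: oprod_def)
qed

lemma oprod_mult:
  fixes f g :: "'v::finite \<Rightarrow> 'v grassmann"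
  assumes "\<And>i. central (f i)" "\<And>i. central (g i)"
  shows "oprod S f * oprod S g = oprod S (\<lambda>i. f i * g i)"
proof -
  have "prod_list (map f xs) * prod_list (map g xs) = prod_list (map (\<lambda>i. f i * g i) xs)" for xs
  proof (induction xs)
    case (Cons x xs)
    have "prod_list (map f (x # xs)) * prod_list (map g (x # xs))
        = f x * (prod_list (map f xs) * g x) * prod_list (map g xs)"
      by (simp add: mult.assoc)
    also have "prod_list (map f xs) * g x = g x * prod_list (map f xs)"
      by (rule centralD[OF assms(2), symmetric])
    also have "f x * (g x * prod_list (map f xs)) * prod_list (map g xs)
        = f x * g x * (prod_list (map f xs) * prod_list (map g xs))"
      by (simp only: mult.assoc)
    finally show ?case by (simp add: Cons)
  qed simp
  then show ?thesis by (simp add: oprod_def)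
qed

lemma oprod_one [simp]: "oprod (S :: 'b::finite set) (\<lambda>_. 1 :: 'a::monoid_mult) = 1"
proof -
  have "prod_list (map (\<lambda>_. 1) xs) = (1 :: 'a)" for xs :: "'b list"
    by (induction xs) auto
  then show ?thesis by (simp add: oprod_def)
qed

lemma central_oprod [intro]:
  fixes f :: "'v::finite \<Rightarrow> 'v grassmann"
  assumes "\<And>i. central (f i)"
  shows "central (oprod S f)"
proof -
  have "central (prod_list (map f xs))" for xs
    by (induction xs) (auto intro: assms)
  then show ?thesis by (simp add: oprod_def)
qed

section \<open>The field \<open>z\<close>\<close>

lemma gen_square_zero [simp]: "gen p * gen p = 0"
  by (rule grassmann_eqI) (simp add: gcoeff_gen_mult)

lemma xi_eta_square_zero: "(xi i * eta i) * (xi i * eta i) = 0"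
proof -
  have "(xi i * eta i) * (xi i * eta i) = xi i * (eta i * xi i) * eta i"
    by (simp only: mult.assoc)
  also have "\<dots> = - ((xi i * xi i) * (eta i * eta i))"
    by (simp only: gen_anticommute[of "Inr i" "Inl i"] mult_minus_left mult_minus_right mult.assoc)
  finally show ?thesis by simp
qed

lemma body_gen_mult: "body (gen p * gen q) = 0"
  using gcoeff_gen_mult[of p q "{}"] by simp

lemma body_of_real [simp]: "body (of_real r) = r"
  by (simp add: gcoeff_of_real)

text \<open>Since \<open>(\<xi>\<^sub>i \<eta>\<^sub>i)\<^sup>2 = 0\<close>, the field \<open>z\<^sub>i\<close> is affine in \<open>\<xi>\<^sub>i \<eta>\<^sub>i\<close>.\<close>

lemma z_field_expand:
  defines "r \<equiv> \<lambda>x y i. 1 + (x $ i)\<^sup>2 + (y $ i)\<^sup>2"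
  shows "z_field x y i = of_real (sqrt (r x y i)) + (1 / sqrt (r x y i)) *\<^sub>R (xi i * eta i)"
proof -
  have pos: "r x y i > 0"
    unfolding r_def by (smt (verit) zero_le_power2)
  have "deriv sqrt (r x y i) = inverse (sqrt (r x y i)) / 2"
    by (rule DERIV_imp_deriv) (rule DERIV_real_sqrt[OF pos])
  moreover have "2 * xi i * eta i = 2 *\<^sub>R (xi i * eta i)"
    by (simp add: scaleR_conv_of_real mult.assoc)
  moreover have "gtaylor sqrt (of_real (r x y i) + 2 *\<^sub>R (xi i * eta i))
      = of_real (sqrt (r x y i)) + deriv sqrt (r x y i) *\<^sub>R (2 *\<^sub>R (xi i * eta i))"
    by (rule gtaylor_square_zero)
      (simp_all add: xi_eta_square_zero body_gen_mult del: body_mult)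
  ultimately show ?thesis
    by (simp add: z_field_def r_def inverse_eq_divide)
qed

lemma central_z_field [intro]: "central (z_field x y i)"
  unfolding z_field_expand by auto

lemma central_X_dot [intro]: "central (X_dot x y i j)"
  unfolding X_dot_def by (intro central_add central_gen_mult central_of_real)

lemma X_dot_commute: "X_dot x y i j = X_dot x y j i"
  by (simp add: X_dot_def mult.commute add_ac)

text \<open>The constraint \<open>v\<^sub>i \<cdot> v\<^sub>i = -1\<close> of the hyperbolic superplane.\<close>

lemma z_field_square: "z_field x y i * z_field x y i = 1 + X_dot x y i i"
proof -
  define r where "r = 1 + (x $ i)\<^sup>2 + (y $ i)\<^sup>2"
  define e where "e = xi i * eta i"
  have pos: "r > 0"
    unfolding r_def by (smt (verit) zero_le_power2)
  have ee: "e * e = 0" by (simp add: e_def xi_eta_square_zero)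
  have "z_field x y i * z_field x y i = of_real (sqrt r * sqrt r) + (2 * (sqrt r * (1 / sqrt r))) *\<^sub>R e"
    unfolding z_field_expand r_def[symmetric] e_def[symmetric]
    by (simp add: algebra_simps ee of_real_def) (simp add: scaleR_left_distrib[symmetric] scaleR_2)
  also have "\<dots> = of_real r + 2 *\<^sub>R e"
    using pos by (simp add: scaleR_2)
  also have "\<dots> = 1 + X_dot x y i i"
    by (simp add: X_dot_def r_def e_def power2_eq_square scaleR_2 add_ac)
  finally show ?thesis .
qed

lemma z_field_inverse: "z_field x y i * gtaylor inverse (z_field x y i) = 1"
proof -
  define r where "r = sqrt (1 + (x $ i)\<^sup>2 + (y $ i)\<^sup>2)"
  define e where "e = xi i * eta i"
  have pos: "r > 0"
    unfolding r_def by (smt (verit) zero_le_power2 real_sqrt_gt_zero)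
  have ee: "e * e = 0" by (simp add: e_def xi_eta_square_zero)
  have be: "body e = 0" by (simp only: e_def body_gen_mult)
  have "(inverse has_real_derivative - (inverse r ^ Suc (Suc 0))) (at r)"
    using pos by (intro DERIV_inverse) auto
  then have d: "deriv inverse r = - (1 / r\<^sup>2)"
    by (intro DERIV_imp_deriv) (simp add: power2_eq_square divide_simps)
  have z: "z_field x y i = of_real r + (1 / r) *\<^sub>R e"
    by (simp add: z_field_expand r_def e_def)
  have G: "gtaylor inverse (of_real r + (1 / r) *\<^sub>R e) = of_real (inverse r) + deriv inverse r *\<^sub>R ((1 / r) *\<^sub>R e)"
    by (rule gtaylor_square_zero) (simp_all add: ee be)
  have "z_field x y i * gtaylor inverse (z_field x y i)
      = (of_real r + (1 / r) *\<^sub>R e) * (of_real (1 / r) - (1 / (r * r * r)) *\<^sub>R e)"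
    unfolding z G d by (simp add: power2_eq_square inverse_eq_divide)
  also have "\<dots> = of_real (r * (1 / r)) + (1 / r * (1 / r) - r * (1 / (r * r * r))) *\<^sub>R e"
    by (simp add: algebra_simps ee of_real_def)
  also have "\<dots> = 1"
    using pos by simp
  finally show ?thesis .
qed

section \<open>Pointwise equality of the integrands\<close>

lemma connected_weighted_graphD:
  assumes "connected_weighted_graph w"
  shows "w i j \<ge> 0" "w i j = w j i" "w i i = 0"
  using assms by (auto simp: connected_weighted_graph_def)

lemma sum_edges:
  fixes h :: "'v::finite \<Rightarrow> 'v \<Rightarrow> 'a::ab_group_add"
  assumes w: "connected_weighted_graph w" and zero: "\<And>i j. w i j = 0 \<Longrightarrow> h i j = 0"
  shows "(\<Sum>i\<in>UNIV. \<Sum>j\<in>UNIV. h i j) = (\<Sum>(i, j)\<in>edges w. h i j + h j i)"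
proof -
  note wD = connected_weighted_graphD[OF w]
  have inj: "to_nat_on UNIV i = to_nat_on UNIV j \<longleftrightarrow> i = j" for i j :: 'v
    by (simp add: inj_on_eq_iff[OF inj_on_to_nat_on])
  have "(\<Sum>i\<in>UNIV. \<Sum>j\<in>UNIV. h i j) = (\<Sum>(i, j)\<in>UNIV. h i j)"
    by (simp add: sum.cartesian_product)
  also have "\<dots> = (\<Sum>(i, j)\<in>edges w \<union> prod.swap ` edges w. h i j)"
  proof (rule sum.mono_neutral_right)
    have "h i j = 0" if "(i, j) \<notin> edges w" "(j, i) \<notin> edges w" for i j
    proof (rule zero)
      consider "i = j" | "to_nat_on UNIV i < to_nat_on UNIV j" | "to_nat_on UNIV j < to_nat_on UNIV i"
        using inj[of i j] by linarith
      then show "w i j = 0"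
        using that wD(1)[of i j] wD(1)[of j i] wD(2)[of i j] wD(3)[of i]
        by cases (auto simp: edges_def)
    qed
    then show "\<forall>p\<in>UNIV - (edges w \<union> prod.swap ` edges w). (case p of (i, j) \<Rightarrow> h i j) = 0"
      by (force simp: image_iff)
  qed auto
  also have "\<dots> = (\<Sum>(i, j)\<in>edges w. h i j) + (\<Sum>(i, j)\<in>prod.swap ` edges w. h i j)"
    by (rule sum.union_disjoint) (auto simp: edges_def)
  also have "(\<Sum>(i, j)\<in>prod.swap ` edges w. h i j) = (\<Sum>(i, j)\<in>edges w. h j i)"
    by (subst sum.reindex) (auto simp: case_prod_beta)
  finally show ?thesis
    by (simp add: sum.distrib case_prod_beta)
qed

text \<open>The quadratic form of the matrix \<open>A\<close> as a sum over the edges.\<close>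

lemma A_matrix_form:
  fixes f :: "'v::finite \<Rightarrow> 'v \<Rightarrow> 'a::real_vector"
  assumes w: "connected_weighted_graph w" and sym: "\<And>i j. f i j = f j i"
  shows "(\<Sum>i\<in>UNIV. \<Sum>j\<in>UNIV. (A_matrix w u $ i $ j) *\<^sub>R f i j)
    = (\<Sum>(i, j)\<in>edges w. w i j *\<^sub>R
        (exp (u $ i - u $ j) *\<^sub>R f j j + exp (u $ j - u $ i) *\<^sub>R f i i - 2 *\<^sub>R f i j))"
proof -
  note wD = connected_weighted_graphD[OF w]
  define h where "h i j = w i j *\<^sub>R (exp (u $ j - u $ i) *\<^sub>R f i i - f i j)" for i j
  have h0: "h i j = 0" if "w i j = 0" for i j
    using that by (simp add: h_def)
  have "(\<Sum>j\<in>UNIV. (A_matrix w u $ i $ j) *\<^sub>R f i j) = (\<Sum>j\<in>UNIV. h i j)" for i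
  proof -
    have "(\<Sum>j\<in>UNIV. (A_matrix w u $ i $ j) *\<^sub>R f i j)
        = (\<Sum>k\<in>UNIV - {i}. w i k * exp (u $ k - u $ i)) *\<^sub>R f i i + (\<Sum>j\<in>UNIV - {i}. (- w i j) *\<^sub>R f i j)"
      by (subst sum.remove[of _ i]) (auto simp: A_matrix_def intro!: sum.cong)
    also have "\<dots> = (\<Sum>j\<in>UNIV - {i}. h i j)"
      by (simp add: h_def scaleR_sum_left sum.distrib[symmetric] scaleR_diff_right)
    also have "\<dots> = (\<Sum>j\<in>UNIV. h i j)"
      by (rule sum.mono_neutral_left) (auto simp: h_def wD)
    finally show ?thesis .
  qed
  then have "(\<Sum>i\<in>UNIV. \<Sum>j\<in>UNIV. (A_matrix w u $ i $ j) *\<^sub>R f i j) = (\<Sum>(i, j)\<in>edges w. h i j + h j i)"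
    by (simp add: sum_edges[OF w h0])
  also have "\<dots> = (\<Sum>(i, j)\<in>edges w. w i j *\<^sub>R
        (exp (u $ i - u $ j) *\<^sub>R f j j + exp (u $ j - u $ i) *\<^sub>R f i i - 2 *\<^sub>R f i j))"
  proof (intro sum.cong refl, clarify)
    fix i j
    show "h i j + h j i = w i j *\<^sub>R
        (exp (u $ i - u $ j) *\<^sub>R f j j + exp (u $ j - u $ i) *\<^sub>R f i i - 2 *\<^sub>R f i j)"
      unfolding h_def wD(2)[of j i] sym[of j i] by (simp add: algebra_simps scaleR_2)
  qed
  finally show ?thesis .
qed

text \<open>
  The energy \<open>\<Sum> w\<^sub>i\<^sub>j (cosh (u\<^sub>i - u\<^sub>j) - 1)\<close> over the edges: minus the exponent of the mixing density at
  \<open>\<theta> = 1\<close>.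
\<close>

definition cosh_energy :: "('v::finite \<Rightarrow> 'v \<Rightarrow> real) \<Rightarrow> real ^ 'v \<Rightarrow> real"
  where "cosh_energy w u =
    (\<Sum>(i, j)\<in>edges w. w i j * (exp (u $ i - u $ j) + exp (u $ j - u $ i) - 2) / 2)"

text \<open>The exponent of the supersymmetric free field in environment \<open>u\<close>.\<close>

definition gaussian_exponent :: "('v::finite \<Rightarrow> 'v \<Rightarrow> real) \<Rightarrow> real ^ 'v \<Rightarrow> real ^ 'v \<Rightarrow> real ^ 'v \<Rightarrow> 'v grassmann"
  where "gaussian_exponent w x y u =
    - (1 / 2) *\<^sub>R (\<Sum>i\<in>UNIV. \<Sum>j\<in>UNIV. (A_matrix w u $ i $ j) *\<^sub>R X_dot x y i j)"

lemma v_dot_eq: "v_dot x y i j = X_dot x y i j - z_field x y i * z_field x y j"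
  by (simp add: v_dot_def X_dot_def algebra_simps)

text \<open>
  The exponents of the mixing density at \<open>\<theta> = z\<close> and of the \<open>H\<^bsup>2|2\<^esup>\<close> model add up to the exponents of the mixing
  density at \<open>\<theta> = 1\<close> and of the free field.
\<close>

lemma exponent_identity:
  fixes w :: "'v::finite \<Rightarrow> 'v \<Rightarrow> real"
  assumes w: "connected_weighted_graph w"
  shows "- (1 / 2) *\<^sub>R (\<Sum>(i, j)\<in>edges w. w i j *\<^sub>R
        (exp (u $ i - u $ j) *\<^sub>R (z_field x y j)\<^sup>2 + exp (u $ j - u $ i) *\<^sub>R (z_field x y i)\<^sup>2
          - 2 *\<^sub>R (z_field x y i * z_field x y j)))
      + (\<Sum>(i, j)\<in>edges w. w i j *\<^sub>R (v_dot x y i j + 1))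
    = of_real (- cosh_energy w u) + gaussian_exponent w x y u"
proof -
  have "- (1 / 2) *\<^sub>R (w i j *\<^sub>R
        (exp (u $ i - u $ j) *\<^sub>R (z_field x y j)\<^sup>2 + exp (u $ j - u $ i) *\<^sub>R (z_field x y i)\<^sup>2
          - 2 *\<^sub>R (z_field x y i * z_field x y j)))
      + w i j *\<^sub>R (v_dot x y i j + 1)
    = of_real (- (w i j * (exp (u $ i - u $ j) + exp (u $ j - u $ i) - 2) / 2))
      + - (1 / 2) *\<^sub>R (w i j *\<^sub>R (exp (u $ i - u $ j) *\<^sub>R X_dot x y j j
        + exp (u $ j - u $ i) *\<^sub>R X_dot x y i i - 2 *\<^sub>R X_dot x y i j))" for i j
  proof (rule grassmann_eqI)
    \<comment> \<open>Coefficientwise this is linear in those of \<open>X_dot\<close> and of the product \<open>P\<close>, which cancels.\<close>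
    fix I
    define P where "P = z_field x y i * z_field x y j"
    show "gcoeff (- (1 / 2) *\<^sub>R (w i j *\<^sub>R
        (exp (u $ i - u $ j) *\<^sub>R (z_field x y j)\<^sup>2 + exp (u $ j - u $ i) *\<^sub>R (z_field x y i)\<^sup>2
          - 2 *\<^sub>R (z_field x y i * z_field x y j)))
      + w i j *\<^sub>R (v_dot x y i j + 1)) I
    = gcoeff (of_real (- (w i j * (exp (u $ i - u $ j) + exp (u $ j - u $ i) - 2) / 2))
      + - (1 / 2) *\<^sub>R (w i j *\<^sub>R (exp (u $ i - u $ j) *\<^sub>R X_dot x y j j
        + exp (u $ j - u $ i) *\<^sub>R X_dot x y i i - 2 *\<^sub>R X_dot x y i j))) I"
      unfolding power2_eq_square z_field_square v_dot_eq P_def[symmetric]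
      by (simp only: gcoeff_add gcoeff_diff gcoeff_scaleR gcoeff_of_real gcoeff_one)
        (simp add: algebra_simps add_divide_distrib diff_divide_distrib)
  qed
  then show ?thesis
    unfolding gaussian_exponent_def A_matrix_form[OF w, of "X_dot x y", OF X_dot_commute] cosh_energy_def
      scaleR_sum_right of_real_minus of_real_sum sum_negf[symmetric] sum.distrib[symmetric]
    by (intro sum.cong) auto
qed


lemma mixing_density_one:
  "mixing_density exp w a (\<lambda>_. 1) u = exp (- cosh_energy w u) * sqrt (tree_sum w u)
    * (\<Prod>i\<in>UNIV - {a}. exp (- u $ i) / sqrt (2 * pi))"
proof -
  have "- (1 / 2) *\<^sub>R (\<Sum>(i, j)\<in>edges w. w i j *\<^sub>R (exp (u $ i - u $ j) *\<^sub>R (1::real)\<^sup>2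
      + exp (u $ j - u $ i) *\<^sub>R 1\<^sup>2 - 2 *\<^sub>R (1 * 1))) = - cosh_energy w u"
    by (simp add: cosh_energy_def case_prod_beta sum_divide_distrib[symmetric])
  then show ?thesis
    by (simp only: mixing_density_def) (simp add: oprod_commutative)
qed

lemma central_rearrange:
  assumes "central a" "central b" "central c"
  shows "a * b * (e * c) * f * d = (e * f) * ((a * c) * (b * d))"
proof -
  have "a * b * (e * c) * f * d = a * (b * (e * (c * f * d)))"
    by (simp only: mult.assoc)
  also have "c * f = f * c" by (rule centralD[OF assms(3)])
  also have "a * (b * (e * (f * c * d))) = a * (b * (e * f) * (c * d))"
    by (simp only: mult.assoc)
  also have "b * (e * f) = (e * f) * b" by (rule centralD[OF assms(2)])
  also have "a * (e * f * b * (c * d)) = a * (e * f) * (b * c) * d"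
    by (simp only: mult.assoc)
  also have "a * (e * f) = e * f * a" by (rule centralD[OF assms(1)])
  also have "b * c = c * b" by (rule centralD[OF assms(2)])
  finally show ?thesis by (simp only: mult.assoc)
qed

text \<open>The exponent of the \<open>H\<^bsup>2|2\<^esup>\<close> model.\<close>

definition H22_exponent :: "('v::finite \<Rightarrow> 'v \<Rightarrow> real) \<Rightarrow> real ^ 'v \<Rightarrow> real ^ 'v \<Rightarrow> 'v grassmann"
  where "H22_exponent w x y = (\<Sum>(i, j)\<in>edges w. w i j *\<^sub>R (v_dot x y i j + 1))"

lemma central_v_dot [intro]: "central (v_dot x y i j)"
  unfolding v_dot_eq by (intro central_diff central_X_dot central_mult central_z_field)

lemma central_H22_exponent [intro]: "central (H22_exponent w x y)"
  unfolding H22_exponent_def case_prod_beta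
  by (intro central_sum central_scaleR central_add central_v_dot central_one)

text \<open>
  The factors \<open>z\<^sub>i\<close> of the mixing density, completed by \<open>z\<^sub>a\<close>, cancel the factors \<open>1/z\<^sub>i\<close> of the
  \<open>H\<^bsup>2|2\<^esup>\<close> measure, completed by \<open>1/z\<^sub>\<delta>\<close>.
\<close>

lemma integrand_identity:
  fixes w :: "'v::finite \<Rightarrow> 'v \<Rightarrow> real"
  assumes w: "connected_weighted_graph w"
  shows "z_field x y a * gtaylor inverse (z_field x y \<delta>) * mixing_density (gtaylor exp) w a (z_field x y) u
      * gtaylor exp (H22_exponent w x y)
      * oprod (UNIV - {\<delta>}) (\<lambda>i. (1 / (2 * pi)) *\<^sub>R gtaylor inverse (z_field x y i))
    = mixing_density exp w a (\<lambda>_. 1) u *\<^sub>R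
      (gtaylor exp (gaussian_exponent w x y u) * of_real (\<Prod>i\<in>UNIV - {\<delta>}. 1 / (2 * pi)))"
proof -
  define Z where "Z = z_field x y"
  define Y where "Y i = gtaylor inverse (Z i)" for i
  have central: "central (Z i)" "central (Y i)" for i
    by (auto simp: Z_def Y_def)
  define E where "E = - (1 / 2) *\<^sub>R (\<Sum>(i, j)\<in>edges w. w i j *\<^sub>R
        (exp (u $ i - u $ j) *\<^sub>R (Z j)\<^sup>2 + exp (u $ j - u $ i) *\<^sub>R (Z i)\<^sup>2 - 2 *\<^sub>R (Z i * Z j)))"
  have "central E"
    unfolding E_def case_prod_beta
    by (intro central_scaleR central_sum central_diff central_add central_power central_mult central)
  then have "gtaylor exp E * gtaylor exp (H22_exponent w x y) = gtaylor exp (E + H22_exponent w x y)"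
    by (rule gtaylor_exp_add[symmetric])
  also have "E + H22_exponent w x y = of_real (- cosh_energy w u) + gaussian_exponent w x y u"
    unfolding E_def Z_def H22_exponent_def by (rule exponent_identity[OF w])
  also have "gtaylor exp \<dots> = exp (- cosh_energy w u) *\<^sub>R gtaylor exp (gaussian_exponent w x y u)"
    by (simp only: gtaylor_exp_add central_of_real gtaylor_exp_of_real scaleR_conv_of_real)
  finally have E: "gtaylor exp E * gtaylor exp (H22_exponent w x y)
      = exp (- cosh_energy w u) *\<^sub>R gtaylor exp (gaussian_exponent w x y u)" .
  define s where "s = sqrt (tree_sum w u)"
  define k where "k = (\<Prod>i\<in>UNIV - {a}. exp (- u $ i) / sqrt (2 * pi))"
  define c where "c = (\<Prod>i\<in>UNIV - {\<delta>}. 1 / (2 * pi))"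
  have ZY: "(Z a * oprod (UNIV - {a}) Z) * (Y \<delta> * oprod (UNIV - {\<delta>}) Y) = 1"
    by (simp add: oprod_remove central oprod_mult) (simp add: Y_def Z_def z_field_inverse)
  have "Z a * Y \<delta> * mixing_density (gtaylor exp) w a Z u * gtaylor exp (H22_exponent w x y)
      * oprod (UNIV - {\<delta>}) (\<lambda>i. (1 / (2 * pi)) *\<^sub>R Y i)
    = (s * k * c) *\<^sub>R (Z a * Y \<delta> * (gtaylor exp E * oprod (UNIV - {a}) Z) * gtaylor exp (H22_exponent w x y)
      * oprod (UNIV - {\<delta>}) Y)"
    unfolding mixing_density_def oprod_scaleR E_def[symmetric] s_def[symmetric] k_def[symmetric] c_def[symmetric]
    by (simp add: of_real_def)
  also have "\<dots> = (s * k * c) *\<^sub>R (gtaylor exp E * gtaylor exp (H22_exponent w x y))"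
    by (subst central_rearrange) (simp_all add: ZY central central_oprod)
  also have "\<dots> = mixing_density exp w a (\<lambda>_. 1) u *\<^sub>R (gtaylor exp (gaussian_exponent w x y u) * of_real c)"
    unfolding E mixing_density_one s_def[symmetric] k_def[symmetric] by (simp add: of_real_def mult_ac)
  finally show ?thesis
    by (simp add: Z_def Y_def c_def)
qed

section \<open>Integrals of Grassmann-valued functions\<close>

lemma left_inverse_mult:
  fixes c d :: "'a::monoid_mult"
  assumes "\<exists>K. K * c = 1" "\<exists>K. K * d = 1"
  shows "\<exists>K. K * (c * d) = 1"
proof -
  obtain K1 K2 where K: "K1 * c = 1" "K2 * d = 1" using assms by blast
  have "K2 * K1 * (c * d) = K2 * (K1 * c) * d" by (simp only: mult.assoc)
  then show ?thesis using K by auto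
qed

lemma gintegral_mult_left:
  assumes "\<And>I. integrable M (\<lambda>t. gcoeff (f t) I)"
  shows "gintegral M (\<lambda>t. c * f t) = c * gintegral M f"
  by (rule grassmann_eqI) (simp add: gintegral_def gcoeff_mult assms mult.assoc)

text \<open>
  The weight \<open>z\<^sub>a/z\<^sub>\<delta>\<close> and the factors of the \<open>H\<^bsup>2|2\<^esup>\<close> measure form an invertible central element, so
  they can be moved into the integral over \<open>u\<close> as soon as the resulting integrand is integrable.
\<close>

lemma H22_mixing_integrand:
  fixes w :: "'v::finite \<Rightarrow> 'v \<Rightarrow> real" and x y :: "real ^ 'v" and g :: "real ^ 'v \<Rightarrow> 'v grassmann" and a \<delta> :: 'v
  assumes w: "connected_weighted_graph w"
  defines "F \<equiv> \<lambda>u. mixing_density exp w a (\<lambda>_. 1) u *\<^sub>R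
      (g u * gtaylor exp (gaussian_exponent w x y u) * of_real (\<Prod>i\<in>UNIV - {\<delta>}. 1 / (2 * pi)))"
  assumes int: "\<And>I. integrable (pinned_lebesgue a 0) (\<lambda>u. gcoeff (F u) I)"
  shows "z_field x y a * gtaylor inverse (z_field x y \<delta>) * mixing_gintegral w a (z_field x y) g
      * gtaylor exp (H22_exponent w x y)
      * oprod (UNIV - {\<delta>}) (\<lambda>i. (1 / (2 * pi)) *\<^sub>R gtaylor inverse (z_field x y i))
    = gintegral (pinned_lebesgue a 0) F"
proof -
  define Z where "Z = z_field x y"
  define Y where "Y i = gtaylor inverse (Z i)" for i
  define E where "E = gtaylor exp (H22_exponent w x y)"
  define P where "P = oprod (UNIV - {\<delta>}) (\<lambda>i. (1 / (2 * pi)) *\<^sub>R Y i)"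
  define m where "m u = mixing_density (gtaylor exp) w a Z u" for u
  have central: "central (Z i)" "central (Y i)" "central E" "central P" for i
    unfolding Z_def Y_def E_def P_def
    by (intro central_z_field central_gtaylor central_oprod central_scaleR central_H22_exponent)+
  define L where "L = Z a * Y \<delta> * E * P"
  have "central L" unfolding L_def by (intro central_mult central)
  have L_eq: "Z a * Y \<delta> * h * E * P = L * h" for h
  proof -
    have "Z a * Y \<delta> * h * E * P = Z a * Y \<delta> * (h * (E * P))"
      by (simp only: mult.assoc)
    also have "h * (E * P) = E * P * h"
      by (rule centralD[symmetric]) (intro central_mult central)
    finally show ?thesis by (simp only: L_def mult.assoc)
  qed
  have "\<exists>K. K * L = 1"
    unfolding L_def
  proof (intro left_inverse_mult)
    have YZ: "Y i * Z i = 1" and ZY: "Z i * Y i = 1" for i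
      using centralD[OF central(1), of i "Y i"] z_field_inverse[of x y i] by (simp_all add: Z_def Y_def)
    then show "\<exists>K. K * Z a = 1" and "\<exists>K. K * Y \<delta> = 1"
      by blast+
    have "gtaylor exp (- H22_exponent w x y) * E = gtaylor exp (- H22_exponent w x y + H22_exponent w x y)"
      unfolding E_def by (rule gtaylor_exp_add[symmetric]) (metis central_H22_exponent central_scaleR scaleR_minus1_left)
    also have "\<dots> = 1"
      using gtaylor_exp_of_real[of 0] by simp
    finally show "\<exists>K. K * E = 1" by blast
    have "oprod (UNIV - {\<delta>}) (\<lambda>i. (2 * pi) *\<^sub>R Z i) * P = 1"
      unfolding P_def by (subst oprod_mult) (auto intro: central simp: ZY)
    then show "\<exists>K. K * P = 1" by blast
  qed
  then obtain K where K: "K * L = 1" by blast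
  have F: "F u = L * (g u * m u)" for u
  proof -
    have "L * m u = mixing_density exp w a (\<lambda>_. 1) u *\<^sub>R
      (gtaylor exp (gaussian_exponent w x y u) * of_real (\<Prod>i\<in>UNIV - {\<delta>}. 1 / (2 * pi)))"
      unfolding L_eq[symmetric] m_def Z_def Y_def E_def P_def by (rule integrand_identity[OF w])
    moreover have "L * (g u * m u) = g u * (L * m u)"
      using centralD[OF \<open>central L\<close>, of "g u"] by (simp only: mult.assoc[symmetric])
    ultimately show ?thesis by (simp add: F_def mult.assoc)
  qed
  have "L * gintegral (pinned_lebesgue a 0) (\<lambda>u. g u * m u) = L * gintegral (pinned_lebesgue a 0) (\<lambda>u. K * F u)"
    by (simp add: F mult.assoc[symmetric] K)
  also have "\<dots> = L * K * gintegral (pinned_lebesgue a 0) F"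
    by (simp add: gintegral_mult_left[OF int] mult.assoc)
  also have "L * K = 1"
    using K centralD[OF \<open>central L\<close>] by metis
  finally show ?thesis
    unfolding mixing_gintegral_def m_def Z_def Y_def E_def P_def L_eq[unfolded Z_def Y_def E_def P_def] by simp
qed

section \<open>The Berezin integral as a linear functional\<close>

text \<open>The basis monomial \<open>e\<^sub>I\<close>.\<close>

definition gbasis :: "('v::finite + 'v) set \<Rightarrow> 'v grassmann"
  where "gbasis I = Grassmann (\<lambda>J. if J = I then 1 else 0)"

lemma gbasis_expansion: "f = (\<Sum>I\<in>UNIV. gcoeff f I *\<^sub>R gbasis I)"
  by (rule grassmann_eqI) (simp add: gbasis_def mult_if_delta if_distrib cong: if_cong)

lemma linear_left_deriv: "linear (left_deriv p)"
  by (rule linearI; rule grassmann_eqI) (auto simp: left_deriv_def algebra_simps)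

lemma linear_berezin: "linear (berezin S)"
proof -
  have "linear (fold (\<lambda>i h. left_deriv (Inl i) (left_deriv (Inr i) h)) xs)" for xs :: "'a list"
  proof (induction xs)
    case (Cons i xs)
    show ?case
      using linear_compose[OF linear_compose[OF linear_left_deriv linear_left_deriv] Cons,
        of "Inl i" "Inr i"] by (simp add: o_def)
  qed (simp add: id_def linear_iff)
  then show ?thesis unfolding berezin_def[abs_def] .
qed

lemma linear_pin_odd: "linear (pin_odd \<delta>)"
  by (rule linearI; rule grassmann_eqI) (auto simp: pin_odd_def)

lemma linear_body: "linear body"
  by (rule linearI) auto

text \<open>
  The integral over the odd variables that enters \<open>super_integral\<close>. It is a linear functional, hence a
  fixed linear combination of the finitely many coefficients, and so commutes with integration over a
  parameter.
\<close>

definition super_body :: "'v \<Rightarrow> 'v::finite grassmann \<Rightarrow> real"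
  where "super_body \<delta> f = body (berezin (UNIV - {\<delta>}) (pin_odd \<delta> f))"

lemma linear_super_body: "linear (super_body \<delta>)"
  using linear_compose[OF linear_compose[OF linear_pin_odd linear_berezin] linear_body]
  by (simp add: o_def super_body_def[abs_def])

lemma super_body_expansion:
  "super_body \<delta> f = (\<Sum>I\<in>UNIV. gcoeff f I * super_body \<delta> (gbasis I))"
  by (subst gbasis_expansion[of f])
    (simp add: linear_sum[OF linear_super_body] linear_cmul[OF linear_super_body])

lemma super_body_gintegral:
  assumes "\<And>I. integrable M (\<lambda>t. gcoeff (f t) I)"
  shows "super_body \<delta> (gintegral M f) = (\<integral>t. super_body \<delta> (f t) \<partial>M)"
  unfolding super_body_expansion[of \<delta> "gintegral M f"] super_body_expansion[of \<delta> "f _"]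
  by (simp add: gintegral_def assms)


section \<open>Growth of the coefficients in \<open>u\<close>\<close>

text \<open>
  Continuous functions of at most exponential growth. Continuity is included because both properties are
  needed of the same functions and are inherited in the same way.
\<close>

definition exp_growth :: "(real ^ 'v::finite \<Rightarrow> real) \<Rightarrow> bool"
  where "exp_growth \<phi> \<longleftrightarrow> continuous_on UNIV \<phi> \<and>
    (\<exists>C m. \<forall>u. \<bar>\<phi> u\<bar> \<le> C * exp (m * (\<Sum>i\<in>UNIV. \<bar>u $ i\<bar>)))"

lemma exp_growth_const [intro]: "exp_growth (\<lambda>_. c)"
  unfolding exp_growth_def by (intro conjI continuous_intros exI[of _ "\<bar>c\<bar>"] exI[of _ 0]) simp

lemma exp_growth_add [intro]:
  assumes "exp_growth \<phi>" "exp_growth \<psi>"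
  shows "exp_growth (\<lambda>u. \<phi> u + \<psi> u)"
proof -
  obtain C m D n where CD: "\<And>u. \<bar>\<phi> u\<bar> \<le> C * exp (m * (\<Sum>i\<in>UNIV. \<bar>u $ i\<bar>))"
    "\<And>u. \<bar>\<psi> u\<bar> \<le> D * exp (n * (\<Sum>i\<in>UNIV. \<bar>u $ i\<bar>))"
    using assms unfolding exp_growth_def by metis
  have pos: "C \<ge> 0" "D \<ge> 0"
    using CD[of 0] by auto
  have "\<bar>\<phi> u + \<psi> u\<bar> \<le> (C + D) * exp (max m n * (\<Sum>i\<in>UNIV. \<bar>u $ i\<bar>))" for u
  proof -
    let ?s = "\<Sum>i\<in>UNIV. \<bar>u $ i\<bar>"
    have "C * exp (m * ?s) \<le> C * exp (max m n * ?s)" "D * exp (n * ?s) \<le> D * exp (max m n * ?s)"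
      using pos by (auto intro!: mult_left_mono mult_right_mono sum_nonneg)
    then show ?thesis
      using CD[of u] by (simp add: distrib_right)
  qed
  then show ?thesis
    using assms unfolding exp_growth_def by (auto intro!: continuous_intros)
qed

lemma exp_growth_mult [intro]:
  assumes "exp_growth \<phi>" "exp_growth \<psi>"
  shows "exp_growth (\<lambda>u. \<phi> u * \<psi> u)"
proof -
  obtain C m D n where CD: "\<And>u. \<bar>\<phi> u\<bar> \<le> C * exp (m * (\<Sum>i\<in>UNIV. \<bar>u $ i\<bar>))"
    "\<And>u. \<bar>\<psi> u\<bar> \<le> D * exp (n * (\<Sum>i\<in>UNIV. \<bar>u $ i\<bar>))"
    using assms unfolding exp_growth_def by metis
  have "\<bar>\<phi> u * \<psi> u\<bar> \<le> (C * D) * exp ((m + n) * (\<Sum>i\<in>UNIV. \<bar>u $ i\<bar>))" for u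
    using mult_mono'[OF CD(1)[of u] CD(2)[of u]]
    by (simp add: abs_mult distrib_right exp_add mult_ac)
  then show ?thesis
    using assms unfolding exp_growth_def by (auto intro!: continuous_intros)
qed

lemma exp_growth_sum [intro]:
  "(\<And>s. s \<in> S \<Longrightarrow> exp_growth (\<phi> s)) \<Longrightarrow> exp_growth (\<lambda>u. \<Sum>s\<in>S. \<phi> s u)"
  by (induction S rule: infinite_finite_induct) auto

lemma exp_growth_prod [intro]:
  "(\<And>s. s \<in> S \<Longrightarrow> exp_growth (\<phi> s)) \<Longrightarrow> exp_growth (\<lambda>u. \<Prod>s\<in>S. \<phi> s u)"
  by (induction S rule: infinite_finite_induct) auto

lemma exp_growth_exp [intro]: "exp_growth (\<lambda>u. exp (r * u $ i))"
proof -
  have "\<bar>exp (r * u $ i)\<bar> \<le> 1 * exp (\<bar>r\<bar> * (\<Sum>i\<in>UNIV. \<bar>u $ i\<bar>))" for u :: "real ^ 'a"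
  proof -
    have "r * u $ i \<le> \<bar>r\<bar> * \<bar>u $ i\<bar>"
      by (metis abs_ge_self abs_mult)
    also have "\<dots> \<le> \<bar>r\<bar> * (\<Sum>i\<in>UNIV. \<bar>u $ i\<bar>)"
      by (intro mult_left_mono member_le_sum) auto
    finally show ?thesis by simp
  qed
  then show ?thesis
    unfolding exp_growth_def
    by (intro conjI continuous_intros exI[of _ 1] exI[of _ "\<bar>r\<bar>"]) auto
qed

lemma exp_growth_sqrt:
  assumes "exp_growth \<phi>" "\<And>u. \<phi> u \<ge> 0"
  shows "exp_growth (\<lambda>u. sqrt (\<phi> u))"
proof -
  have "exp_growth (\<lambda>u. 1 + \<phi> u)"
    using assms(1) by (intro exp_growth_add exp_growth_const)
  then obtain C m where C: "\<And>u. \<bar>1 + \<phi> u\<bar> \<le> C * exp (m * (\<Sum>i\<in>UNIV. \<bar>u $ i\<bar>))"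
    unfolding exp_growth_def by blast
  have "sqrt t \<le> 1 + t" if "t \<ge> 0" for t
    by (rule real_le_lsqrt) (use that in \<open>auto simp: power2_eq_square algebra_simps\<close>)
  then have "\<bar>sqrt (\<phi> u)\<bar> \<le> C * exp (m * (\<Sum>i\<in>UNIV. \<bar>u $ i\<bar>))" for u
    using C[of u] assms(2)[of u] real_sqrt_ge_zero[of "\<phi> u"] by fastforce
  then show ?thesis
    using assms(1) unfolding exp_growth_def by (auto intro!: continuous_intros)
qed

lemma exp_growth_exp_diff [intro]: "exp_growth (\<lambda>u. exp (u $ i - u $ j))"
  using exp_growth_mult[OF exp_growth_exp[of 1 i] exp_growth_exp[of "-1" j]]
  by (simp add: exp_add[symmetric])

lemma tree_sum_nonneg: "connected_weighted_graph w \<Longrightarrow> tree_sum w u \<ge> 0"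
  unfolding tree_sum_def
  by (intro sum_nonneg prod_nonneg) (auto simp: connected_weighted_graph_def)

lemma exp_growth_tree_sum [intro]: "exp_growth (tree_sum w)"
proof -
  have "exp_growth (\<lambda>u. exp (u $ i + u $ j))" for i j :: 'a
    using exp_growth_mult[OF exp_growth_exp[of 1 i] exp_growth_exp[of 1 j]] by (simp add: exp_add)
  then show ?thesis
    unfolding tree_sum_def[abs_def] case_prod_beta
    by (intro exp_growth_sum exp_growth_prod exp_growth_mult exp_growth_const)
qed

lemma exp_growth_A_matrix [intro]: "exp_growth (\<lambda>u. A_matrix w u $ i $ j)"
proof (cases "i = j")
  case True
  then show ?thesis
    unfolding A_matrix_def vec_lambda_beta if_P[OF True]
    by (intro exp_growth_sum exp_growth_mult exp_growth_const exp_growth_exp_diff)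
qed (auto simp: A_matrix_def)

text \<open>Grassmann-valued functions all of whose coefficients have at most exponential growth.\<close>

definition gexp_growth :: "(real ^ 'v::finite \<Rightarrow> 'v grassmann) \<Rightarrow> bool"
  where "gexp_growth F \<longleftrightarrow> (\<forall>I. exp_growth (\<lambda>u. gcoeff (F u) I))"

lemma gexp_growth_const [intro]: "gexp_growth (\<lambda>_. c)"
  by (auto simp: gexp_growth_def)

lemma gexp_growth_scaleR [intro]: "exp_growth \<phi> \<Longrightarrow> gexp_growth F \<Longrightarrow> gexp_growth (\<lambda>u. \<phi> u *\<^sub>R F u)"
  by (auto simp: gexp_growth_def)

lemma gexp_growth_mult [intro]: "gexp_growth F \<Longrightarrow> gexp_growth G \<Longrightarrow> gexp_growth (\<lambda>u. F u * G u)"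
  unfolding gexp_growth_def gcoeff_mult
  by (intro allI exp_growth_sum exp_growth_mult exp_growth_const) auto

lemma gexp_growth_power [intro]: "gexp_growth F \<Longrightarrow> gexp_growth (\<lambda>u. F u ^ k)"
  by (induction k) auto

lemma gexp_growth_sum [intro]:
  "(\<And>s. s \<in> S \<Longrightarrow> gexp_growth (F s)) \<Longrightarrow> gexp_growth (\<lambda>u. \<Sum>s\<in>S. F s u)"
  by (auto simp: gexp_growth_def)

lemma gexp_growth_nilexp [intro]: "gexp_growth F \<Longrightarrow> gexp_growth (\<lambda>u. nilexp (F u))"
  unfolding nilexp_def by (intro gexp_growth_sum gexp_growth_scaleR gexp_growth_power exp_growth_const)

section \<open>Decay of the mixing density\<close>

lemma cosh_lower: "exp t + exp (- t) - 2 \<ge> t\<^sup>2 / 2" for t :: real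
proof -
  have "exp t + exp (- t) - 2 \<ge> t\<^sup>2 / 2" if "t \<ge> 0" for t :: real
    using exp_lower_Taylor_quadratic[OF that] exp_ge_add_one_self[of "- t"] by simp
  from this[of t] this[of "- t"] show ?thesis by (cases "t \<ge> 0") auto
qed

text \<open>Follow a path from \<open>a\<close> to \<open>i\<close>.\<close>

lemma vertex_distance_bound:
  fixes w :: "'v::finite \<Rightarrow> 'v \<Rightarrow> real"
  assumes w: "connected_weighted_graph w"
  shows "\<exists>K\<ge>0. \<forall>u :: real ^ 'v. \<bar>u $ i - u $ a\<bar> \<le> K * (\<Sum>(k, l)\<in>edges w. \<bar>u $ k - u $ l\<bar>)"
proof -
  let ?S = "\<lambda>u :: real ^ 'v. \<Sum>(k, l)\<in>edges w. \<bar>u $ k - u $ l\<bar>"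
  have "(a, i) \<in> {(k, l). w k l > 0}\<^sup>*"
    using w by (auto simp: connected_weighted_graph_def)
  then show ?thesis
  proof induction
    case base
    show ?case by (intro exI[of _ 0]) auto
  next
    case (step k l)
    then obtain K where K: "K \<ge> 0" "\<And>u. \<bar>u $ k - u $ a\<bar> \<le> K * ?S u" by blast
    have kl: "w k l > 0" "w l k > 0" "k \<noteq> l"
      using step connected_weighted_graphD[OF w] by (auto simp: less_le)
    have "(k, l) \<in> edges w \<or> (l, k) \<in> edges w"
      using kl inj_on_to_nat_on[of "UNIV :: 'v set"] unfolding edges_def
      by (auto simp: linorder_neq_iff[symmetric] inj_on_eq_iff)
    then have edge: "\<bar>u $ l - u $ k\<bar> \<le> ?S u" for u
      using member_le_sum[of "(k, l)" "edges w" "\<lambda>(k, l). \<bar>u $ k - u $ l\<bar>"]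
        member_le_sum[of "(l, k)" "edges w" "\<lambda>(k, l). \<bar>u $ k - u $ l\<bar>"]
      by (auto simp: abs_minus_commute)
    have "\<bar>u $ l - u $ a\<bar> \<le> (K + 1) * ?S u" for u
    proof -
      have "\<bar>u $ l - u $ a\<bar> \<le> \<bar>u $ l - u $ k\<bar> + \<bar>u $ k - u $ a\<bar>"
        by arith
      also have "\<dots> \<le> ?S u + K * ?S u"
        by (intro add_mono K edge)
      also have "\<dots> = (K + 1) * ?S u"
        by (simp only: distrib_right mult_1 add.commute)
      finally show ?thesis .
    qed
    then show ?case using K(1) by (intro exI[of _ "K + 1"]) auto
  qed
qed

text \<open>
  On a connected graph the sum of the gradients over the edges controls all \<open>u\<^sub>i - u\<^sub>a\<close>, and the
  energy grows at least quadratically in the gradients.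
\<close>

lemma exp_energy_bound:
  fixes w :: "'v::finite \<Rightarrow> 'v \<Rightarrow> real"
  assumes w: "connected_weighted_graph w" and \<phi>: "exp_growth \<phi>"
  shows "\<exists>C. \<forall>u. u $ a = 0 \<longrightarrow> \<bar>exp (- cosh_energy w u) * \<phi> u\<bar> \<le> C"
proof -
  let ?S = "\<lambda>u :: real ^ 'v. \<Sum>(k, l)\<in>edges w. \<bar>u $ k - u $ l\<bar>"
  obtain C m where C: "\<And>u. \<bar>\<phi> u\<bar> \<le> C * exp (m * (\<Sum>i\<in>UNIV. \<bar>u $ i\<bar>))"
    using \<phi> unfolding exp_growth_def by blast
  have "C \<ge> 0" using C[of 0] by auto
  obtain K where K: "\<And>i. K i \<ge> 0" "\<And>i u. \<bar>u $ i - u $ a\<bar> \<le> K i * ?S u"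
    using vertex_distance_bound[OF w, of _ a] by metis
  \<comment> \<open>After inserting \<open>K\<close>, the exponent of the growth bound is at most \<open>M\<close> times the sum of the gradients.\<close>
  define M where "M = \<bar>m\<bar> * (\<Sum>i\<in>UNIV. K i)"
  have "\<bar>exp (- cosh_energy w u) * \<phi> u\<bar> \<le> C * exp (\<Sum>(k, l)\<in>edges w. M\<^sup>2 / w k l)" if u: "u $ a = 0" for u
  proof -
    have "(\<Sum>i\<in>UNIV. \<bar>u $ i\<bar>) \<le> (\<Sum>i\<in>UNIV. K i * ?S u)"
      using K(2)[of u] u by (intro sum_mono) auto
    then have "\<bar>m\<bar> * (\<Sum>i\<in>UNIV. \<bar>u $ i\<bar>) \<le> \<bar>m\<bar> * (\<Sum>i\<in>UNIV. K i * ?S u)"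
      by (rule mult_left_mono) simp
    then have "m * (\<Sum>i\<in>UNIV. \<bar>u $ i\<bar>) \<le> M * ?S u"
      using mult_right_mono[OF abs_ge_self[of m], of "\<Sum>i\<in>UNIV. \<bar>u $ i\<bar>"]
      by (simp add: M_def sum_distrib_right[symmetric] mult.assoc sum_nonneg)
    moreover have "M * ?S u - cosh_energy w u \<le> (\<Sum>(k, l)\<in>edges w. M\<^sup>2 / w k l)"
      unfolding cosh_energy_def sum_distrib_left sum_subtractf[symmetric] case_prod_beta
    proof (rule sum_mono)
      fix e assume "e \<in> edges w"
      then have pos: "w (fst e) (snd e) > 0" by (auto simp: edges_def)
      define t where "t = u $ fst e - u $ snd e"
      define c where "c = w (fst e) (snd e)"
      have "c * (exp t + exp (- t) - 2) / 2 \<ge> c * (t\<^sup>2 / 2) / 2"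
        using cosh_lower[of t] pos by (intro divide_right_mono mult_left_mono) (auto simp: c_def)
      moreover have "M * \<bar>t\<bar> - c * (t\<^sup>2 / 2) / 2 \<le> M\<^sup>2 / c"
      proof -
        \<comment> \<open>Completing the square in \<open>t\<close>.\<close>
        have "0 \<le> (M - c * \<bar>t\<bar> / 2)\<^sup>2 / c"
          using pos by (simp add: c_def)
        also have "\<dots> = M\<^sup>2 / c - (M * \<bar>t\<bar> - c * (t\<^sup>2 / 2) / 2)"
          using pos by (simp add: c_def field_simps power2_eq_square)
        finally show ?thesis by simp
      qed
      ultimately show "M * \<bar>u $ fst e - u $ snd e\<bar> - w (fst e) (snd e) *
          (exp (u $ fst e - u $ snd e) + exp (u $ snd e - u $ fst e) - 2) / 2
          \<le> M\<^sup>2 / w (fst e) (snd e)"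
        by (simp add: t_def c_def)
    qed
    ultimately have exp: "exp (- cosh_energy w u + m * (\<Sum>i\<in>UNIV. \<bar>u $ i\<bar>)) \<le> exp (\<Sum>(k, l)\<in>edges w. M\<^sup>2 / w k l)"
      by simp
    have "\<bar>exp (- cosh_energy w u) * \<phi> u\<bar> \<le> exp (- cosh_energy w u) * (C * exp (m * (\<Sum>i\<in>UNIV. \<bar>u $ i\<bar>)))"
      unfolding abs_mult using C[of u] by (intro mult_mono) auto
    also have "\<dots> = C * exp (- cosh_energy w u + m * (\<Sum>i\<in>UNIV. \<bar>u $ i\<bar>))"
      by (simp only: exp_add mult_ac)
    also have "\<dots> \<le> C * exp (\<Sum>(k, l)\<in>edges w. M\<^sup>2 / w k l)"
      by (rule mult_left_mono[OF exp \<open>C \<ge> 0\<close>])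
    finally show ?thesis .
  qed
  then show ?thesis by blast
qed

section \<open>The Gaussian factor\<close>

text \<open>The nilpotent part and the real part of \<open>gaussian_exponent\<close>; the former depends on \<open>u\<close> only.\<close>

definition gaussian_soul :: "('v::finite \<Rightarrow> 'v \<Rightarrow> real) \<Rightarrow> real ^ 'v \<Rightarrow> 'v grassmann"
  where "gaussian_soul w u =
    - (1 / 2) *\<^sub>R (\<Sum>i\<in>UNIV. \<Sum>j\<in>UNIV. (A_matrix w u $ i $ j) *\<^sub>R (xi i * eta j + xi j * eta i))"

definition gaussian_body :: "('v::finite \<Rightarrow> 'v \<Rightarrow> real) \<Rightarrow> real ^ 'v \<Rightarrow> real ^ 'v \<Rightarrow> real ^ 'v \<Rightarrow> real"
  where "gaussian_body w x y u =
    - (1 / 2) * (\<Sum>i\<in>UNIV. \<Sum>j\<in>UNIV. (A_matrix w u $ i $ j) * (x $ i * x $ j + y $ i * y $ j))"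

lemma gtaylor_gaussian:
  "gtaylor exp (gaussian_exponent w x y u) = exp (gaussian_body w x y u) *\<^sub>R nilexp (gaussian_soul w u)"
proof -
  have body: "body (gaussian_exponent w x y u) = gaussian_body w x y u"
    unfolding gaussian_exponent_def gaussian_body_def X_dot_def
    by (simp only: gcoeff_scaleR gcoeff_sum gcoeff_add body_gen_mult body_of_real add_0_right)
  have "gaussian_exponent w x y u = of_real (gaussian_body w x y u) + gaussian_soul w u"
  proof (rule grassmann_eqI)
    fix I
    show "gcoeff (gaussian_exponent w x y u) I = gcoeff (of_real (gaussian_body w x y u) + gaussian_soul w u) I"
      unfolding gaussian_exponent_def gaussian_body_def gaussian_soul_def X_dot_def
      by (cases "I = {}")
         (simp_all add: gcoeff_of_real distrib_left sum.distrib add.assoc del: body_mult of_real_mult of_real_add)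
  qed
  then have "gaussian_exponent w x y u - of_real (gaussian_body w x y u) = gaussian_soul w u"
    by simp
  then show ?thesis
    unfolding gtaylor_exp body by simp
qed

text \<open>
  The quadratic form of \<open>A\<close> is a sum over the edges of
  \<open>w\<^sub>i\<^sub>j (exp ((u\<^sub>i - u\<^sub>j) / 2) x\<^sub>j - exp ((u\<^sub>j - u\<^sub>i) / 2) x\<^sub>i)\<^sup>2\<close> and the same squares in \<open>y\<close>.
\<close>

lemma gaussian_body_nonpos:
  assumes w: "connected_weighted_graph w"
  shows "gaussian_body w x y u \<le> 0"
proof -
  have square: "exp (s - t) * p\<^sup>2 + exp (t - s) * q\<^sup>2 - 2 * (q * p) \<ge> 0" for s t p q :: real
  proof -
    define \<alpha> \<beta> where "\<alpha> = exp ((s - t) / 2)" and "\<beta> = exp ((t - s) / 2)"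
    have "\<alpha> * \<beta> = 1"
      by (simp add: \<alpha>_def \<beta>_def exp_add[symmetric] add_divide_distrib[symmetric])
    have exps: "exp (s - t) = \<alpha>\<^sup>2" "exp (t - s) = \<beta>\<^sup>2"
      by (simp_all add: \<alpha>_def \<beta>_def exp_double[symmetric])
    have "(\<alpha> * p - \<beta> * q)\<^sup>2 = \<alpha>\<^sup>2 * p\<^sup>2 + \<beta>\<^sup>2 * q\<^sup>2 - 2 * (\<alpha> * \<beta>) * (q * p)"
      by (simp add: power2_eq_square algebra_simps)
    then have "exp (s - t) * p\<^sup>2 + exp (t - s) * q\<^sup>2 - 2 * (q * p) = (\<alpha> * p - \<beta> * q)\<^sup>2"
      by (simp add: exps \<open>\<alpha> * \<beta> = 1\<close>)
    then show ?thesis by simp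
  qed
  define f where "f i j = x $ i * x $ j + y $ i * y $ j" for i j
  have "(\<Sum>i\<in>UNIV. \<Sum>j\<in>UNIV. (A_matrix w u $ i $ j) *\<^sub>R f i j) = (\<Sum>(i, j)\<in>edges w. w i j *\<^sub>R
        (exp (u $ i - u $ j) *\<^sub>R f j j + exp (u $ j - u $ i) *\<^sub>R f i i - 2 *\<^sub>R f i j))"
    by (rule A_matrix_form[OF w]) (simp add: f_def mult.commute)
  also have "\<dots> \<ge> 0"
  proof (intro sum_nonneg, clarify)
    fix i j
    have "exp (u $ i - u $ j) * f j j + exp (u $ j - u $ i) * f i i - 2 * f i j
      = (exp (u $ i - u $ j) * (x $ j)\<^sup>2 + exp (u $ j - u $ i) * (x $ i)\<^sup>2 - 2 * (x $ i * x $ j))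
      + (exp (u $ i - u $ j) * (y $ j)\<^sup>2 + exp (u $ j - u $ i) * (y $ i)\<^sup>2 - 2 * (y $ i * y $ j))"
      by (simp add: f_def power2_eq_square algebra_simps)
    also have "\<dots> \<ge> 0"
      by (intro add_nonneg_nonneg square)
    finally show "0 \<le> w i j *\<^sub>R (exp (u $ i - u $ j) *\<^sub>R f j j + exp (u $ j - u $ i) *\<^sub>R f i i - 2 *\<^sub>R f i j)"
      using connected_weighted_graphD(1)[OF w, of i j] by simp
  qed
  finally have "(\<Sum>i\<in>UNIV. \<Sum>j\<in>UNIV. (A_matrix w u $ i $ j) * f i j) \<ge> 0"
    by simp
  then show ?thesis by (simp add: gaussian_body_def f_def)
qed

lemma gexp_growth_soul: "gexp_growth (gaussian_soul w)"
  unfolding gaussian_soul_def[abs_def]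
  by (intro gexp_growth_scaleR gexp_growth_sum gexp_growth_const exp_growth_const exp_growth_A_matrix)

lemma mixing_density_growth:
  assumes w: "connected_weighted_graph w"
  shows "\<exists>\<tau>. exp_growth \<tau> \<and> (\<forall>u. \<tau> u \<ge> 0) \<and>
    (\<forall>u. mixing_density exp w a (\<lambda>_. 1) u = exp (- cosh_energy w u) * \<tau> u)"
proof (intro exI conjI allI)
  let ?\<tau> = "\<lambda>u. sqrt (tree_sum w u) * (\<Prod>i\<in>UNIV - {a}. exp ((- 1) * u $ i) * (1 / sqrt (2 * pi)))"
  show "exp_growth ?\<tau>"
    by (intro exp_growth_mult exp_growth_sqrt exp_growth_prod exp_growth_exp exp_growth_const
        exp_growth_tree_sum tree_sum_nonneg[OF w])
  show "?\<tau> u \<ge> 0" for u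
    by (intro mult_nonneg_nonneg prod_nonneg) (auto intro: tree_sum_nonneg[OF w])
  show "mixing_density exp w a (\<lambda>_. 1) u = exp (- cosh_energy w u) * ?\<tau> u" for u
    by (simp add: mixing_density_one)
qed


section \<open>Pinned Lebesgue measure\<close>

lemma measurable_pin:
  "(\<lambda>f. \<chi> i. if i = k then c else f i) \<in> Pi\<^sub>M (UNIV - {k}) (\<lambda>_. lborel) \<rightarrow>\<^sub>M (borel :: (real ^ 'v::finite) measure)"
proof (rule iffD2[OF borel_measurable_euclidean_space], rule ballI)
  fix b :: "real ^ 'v" assume "b \<in> Basis"
  then have "\<exists>i. b = axis i 1"
    by (simp add: Basis_vec_def)
  then obtain i where b: "b = axis i 1" ..
  have "(\<lambda>f. if i = k then c else f i) \<in> borel_measurable (Pi\<^sub>M (UNIV - {k}) (\<lambda>_. lborel))"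
  proof (cases "i = k")
    case False
    then have "(\<lambda>f. f i) \<in> Pi\<^sub>M (UNIV - {k}) (\<lambda>_. lborel) \<rightarrow>\<^sub>M (lborel :: real measure)"
      by (intro measurable_component_singleton) auto
    then show ?thesis using False by simp
  qed simp
  then show "(\<lambda>f. (\<chi> i. if i = k then c else f i) \<bullet> b) \<in> borel_measurable (Pi\<^sub>M (UNIV - {k}) (\<lambda>_. lborel))"
    by (simp add: b inner_axis)
qed

lemma sets_pinned_lebesgue [simp, measurable_cong]: "sets (pinned_lebesgue k c) = sets borel"
  and space_pinned_lebesgue [simp]: "space (pinned_lebesgue k c) = UNIV"
  by (simp_all add: pinned_lebesgue_def)

interpretation lborel_product: product_sigma_finite "\<lambda>_. lborel :: real measure"
  by (simp add: product_sigma_finite_def sigma_finite_lborel)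

text \<open>The space is exhausted by slabs that are bounded in all coordinates except the pinned one.\<close>

lemma sigma_finite_pinned_lebesgue: "sigma_finite_measure (pinned_lebesgue (k :: 'v::finite) c)"
proof
  let ?A = "\<lambda>n::nat. {v :: real ^ 'v. \<forall>i\<in>UNIV - {k}. v $ i \<in> {- real n..real n}}"
  show "\<exists>A. countable A \<and> A \<subseteq> sets (pinned_lebesgue k c) \<and> \<Union> A = space (pinned_lebesgue k c) \<and>
      (\<forall>a\<in>A. emeasure (pinned_lebesgue k c) a \<noteq> \<infinity>)"
  proof (intro exI[of _ "range ?A"] conjI)
    have closed: "closed (?A n)" for n
    proof -
      have "?A n = (\<Inter>i\<in>UNIV - {k}. {v. - real n \<le> v $ i} \<inter> {v. v $ i \<le> real n})"
        by auto
      then show ?thesis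
        by (simp only:) (intro closed_INT ballI closed_Int closed_Collect_le continuous_intros)
    qed
    then show "range ?A \<subseteq> sets (pinned_lebesgue k c)"
      by auto
    have "\<exists>n. v \<in> ?A n" for v :: "real ^ 'v"
    proof -
      obtain n where n: "norm v \<le> real n" using real_arch_simple by blast
      have "\<bar>v $ i\<bar> \<le> real n" for i
        using component_le_norm_cart[of v i] n by linarith
      then have "v \<in> ?A n" by (auto simp: abs_le_iff minus_le_iff)
      then show ?thesis ..
    qed
    then show "\<Union> (range ?A) = space (pinned_lebesgue k c)"
      by auto
    show "\<forall>a\<in>range ?A. emeasure (pinned_lebesgue k c) a \<noteq> \<infinity>"
    proof clarify
      fix n assume inf: "emeasure (pinned_lebesgue k c) (?A n) = \<infinity>"
      have "emeasure (pinned_lebesgue k c) (?A n) = emeasure (Pi\<^sub>M (UNIV - {k}) (\<lambda>_. lborel))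
          (Pi\<^sub>E (UNIV - {k}) (\<lambda>_. {- real n..real n}))"
        unfolding pinned_lebesgue_def
        by (subst emeasure_distr[OF measurable_pin])
          (use closed in \<open>auto simp: space_PiM PiE_def Pi_def intro!: arg_cong2[where f = emeasure]\<close>)
      also have "\<dots> = (\<Prod>i\<in>UNIV - {k}. emeasure lborel {- real n..real n})"
        by (rule lborel_product.emeasure_PiM) auto
      also have "\<dots> < \<infinity>"
        by (simp add: ennreal_power less_top[symmetric])
      finally show False using inf by simp
    qed
  qed auto
qed

lemma AE_pinned_lebesgue: "AE v in pinned_lebesgue k c. v $ k = c"
  unfolding pinned_lebesgue_def
  by (subst AE_distr_iff[OF measurable_pin]) auto

text \<open>
  An integrable majorant for functions of rapid decay, over the coordinates other than the pinned one.
\<close>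

definition decay_weight :: "'v::finite \<Rightarrow> real ^ 'v \<Rightarrow> real"
  where "decay_weight k v = (\<Prod>i\<in>UNIV - {k}. inverse (1 + (v $ i)\<^sup>2))"

lemma decay_weight_nonneg [simp]: "decay_weight k v \<ge> 0"
  unfolding decay_weight_def by (intro prod_nonneg) auto

lemma integrable_decay_weight: "integrable (pinned_lebesgue k c) (decay_weight k)"
proof -
  have int: "integrable lborel (\<lambda>t::real. inverse (1 + t\<^sup>2))"
    using integrable_inverse_1_plus_square
    by (simp add: set_integrable_def einterval_eq_UNIV)
  have "integrable (Pi\<^sub>M (UNIV - {k}) (\<lambda>_. lborel)) (\<lambda>f :: _ \<Rightarrow> real. \<Prod>i\<in>UNIV - {k}. inverse (1 + (f i)\<^sup>2))"
    using lborel_product.product_integrable_prod[of "UNIV - {k}" "\<lambda>_ t. inverse (1 + t\<^sup>2)"] int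
    by simp
  also have "(\<lambda>f. \<Prod>i\<in>UNIV - {k}. inverse (1 + (f i)\<^sup>2))
      = (\<lambda>f. decay_weight k (\<chi> i. if i = k then c else f i))"
    by (auto simp: decay_weight_def intro!: prod.cong)
  finally show ?thesis
    unfolding pinned_lebesgue_def
    by (subst integrable_distr_eq[OF measurable_pin]) (auto simp: decay_weight_def[abs_def])
qed

lemma integrable_pair_mult:
  fixes f :: "'a \<Rightarrow> real" and g :: "'b \<Rightarrow> real"
  assumes "sigma_finite_measure M" "sigma_finite_measure N" "integrable M f" "integrable N g"
  shows "integrable (M \<Otimes>\<^sub>M N) (\<lambda>(x, y). f x * g y)"
proof -
  interpret pair_sigma_finite M N using assms by (simp add: pair_sigma_finite_def)
  have [measurable]: "f \<in> borel_measurable M" "g \<in> borel_measurable N"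
    using assms by auto
  show ?thesis
    by (rule Fubini_integrable) (use assms in \<open>auto simp: abs_mult\<close>)
qed


lemma one_plus_square_le:
  assumes "\<bar>t\<bar> \<le> (r::real)"
  shows "1 + t\<^sup>2 \<le> (1 + r)\<^sup>2"
proof -
  have "t\<^sup>2 \<le> r\<^sup>2" using power_mono[OF assms, of 2] by simp
  then show ?thesis using assms by (simp add: power2_sum)
qed

lemma test_function_bound:
  fixes g :: "real ^ 'v \<Rightarrow> real ^ 'v \<Rightarrow> real ^ 'v \<Rightarrow> 'v::finite grassmann"
  assumes "test_function g"
  shows "\<exists>C\<ge>0. \<forall>x y u. \<bar>gcoeff (g x y u) I\<bar> \<le> C * (decay_weight \<delta> x * decay_weight \<delta> y * decay_weight a u)"
proof -
  \<comment> \<open>Each factor \<open>1 + t\<^sup>2\<close> of the inverse weights is at most \<open>(1 + norm p)\<^sup>2\<close>.\<close>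
  define N where "N k = 2 * card (UNIV - {k})" for k :: 'v
  define c where "c = (\<lambda>(x, y, u). gcoeff (g x y u) I)"
  have "rapid_decay c"
    using assms unfolding test_function_def Let_def c_def by blast
  then obtain C where C: "\<And>p. \<bar>c p\<bar> * (1 + norm p) ^ (N \<delta> + N \<delta> + N a) \<le> C"
    unfolding rapid_decay_def by blast
  define P where "P k v = (\<Prod>i\<in>UNIV - {k}. 1 + (v $ i)\<^sup>2)" for k :: 'v and v :: "real ^ 'v"
  have P_pos: "P k v > 0" for k v
    unfolding P_def by (intro prod_pos) (auto intro: add_pos_nonneg)
  have P_le: "P k v \<le> (1 + r) ^ N k" if "norm v \<le> r" for k v r
  proof -
    have "P k v \<le> (\<Prod>i\<in>UNIV - {k}. (1 + r)\<^sup>2)"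
      unfolding P_def using component_le_norm_cart[of v] that
      by (intro prod_mono conjI one_plus_square_le) (auto intro: order_trans)
    then show ?thesis by (simp add: N_def power_mult)
  qed
  have weight: "decay_weight k v = inverse (P k v)" for k v
    using prod_inversef[of "\<lambda>i. 1 + (v $ i)\<^sup>2" "UNIV - {k}"]
    unfolding decay_weight_def P_def by (simp add: o_def)
  have "\<bar>gcoeff (g x y u) I\<bar> \<le> C * (decay_weight \<delta> x * decay_weight \<delta> y * decay_weight a u)" for x y u
  proof -
    define r where "r = norm (x, y, u)"
    have r: "norm x \<le> r" "norm y \<le> r" "norm u \<le> r"
      unfolding r_def using norm_fst_le[of x "(y, u)"] norm_snd_le[of "(y, u)" x]
        norm_fst_le[of y u] norm_snd_le[of u y] by linarith+
    have "P \<delta> x * P \<delta> y * P a u \<le> (1 + r) ^ N \<delta> * (1 + r) ^ N \<delta> * (1 + r) ^ N a"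
      using r P_pos by (intro mult_mono P_le mult_nonneg_nonneg) (auto intro: less_imp_le simp: r_def)
    also have "\<dots> = (1 + r) ^ (N \<delta> + N \<delta> + N a)"
      by (simp add: power_add)
    finally have "\<bar>gcoeff (g x y u) I\<bar> * (P \<delta> x * P \<delta> y * P a u) \<le> \<bar>gcoeff (g x y u) I\<bar> * \<dots>"
      by (rule mult_left_mono) simp
    also have "\<dots> \<le> C"
      using C[of "(x, y, u)"] by (simp add: c_def r_def)
    finally show ?thesis
      using P_pos[of \<delta> x] P_pos[of \<delta> y] P_pos[of a u]
      by (simp add: weight field_simps)
  qed
  moreover have "C \<ge> 0"
    using C[of 0] by simp
  ultimately show ?thesis by blast
qed

lemma test_function_continuous:
  assumes "test_function g"
  shows "continuous_on UNIV (\<lambda>((x, y), u). gcoeff (g x y u) I)"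
proof -
  have "smooth (\<lambda>(x, y, u). gcoeff (g x y u) I)"
    using assms unfolding test_function_def Let_def by blast
  then have "C_k 0 (\<lambda>(x, y, u). gcoeff (g x y u) I)"
    unfolding smooth_def by blast
  then have c: "continuous_on UNIV (\<lambda>(x, y, u). gcoeff (g x y u) I)"
    by simp
  have "continuous_on UNIV (\<lambda>p. (\<lambda>(x, y, u). gcoeff (g x y u) I) (fst (fst p), snd (fst p), snd p))"
    by (rule continuous_on_compose2[OF c]) (auto intro!: continuous_intros)
  then show ?thesis
    by (simp add: case_prod_beta)
qed

section \<open>Integrability and exchange of the integrals\<close>

text \<open>The integrand of the free expectation.\<close>

definition free_integrand ::
    "('v::finite \<Rightarrow> 'v \<Rightarrow> real) \<Rightarrow> 'v \<Rightarrow> (real ^ 'v \<Rightarrow> real ^ 'v \<Rightarrow> real ^ 'v \<Rightarrow> 'v grassmann) \<Rightarrow>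
      real ^ 'v \<Rightarrow> real ^ 'v \<Rightarrow> real ^ 'v \<Rightarrow> 'v grassmann"
  where "free_integrand w \<delta> g x y u =
      g x y u * gtaylor exp (gaussian_exponent w x y u) * of_real (\<Prod>i\<in>UNIV - {\<delta>}. 1 / (2 * pi))"

text \<open>The factors \<open>\<kappa> (I, J)\<close> collect signs, powers of \<open>2 \<pi>\<close> and the coefficients of the exponential of the soul.\<close>

lemma free_integrand_coeff:
  "\<exists>\<kappa>. (\<forall>K. exp_growth (\<kappa> K)) \<and> (\<forall>g x y u I. gcoeff (free_integrand w \<delta> g x y u) I
      = (\<Sum>J\<in>Pow I. gcoeff (g x y u) J * (exp (gaussian_body w x y u) * \<kappa> (I, J) u)))"
proof -
  define c where "c = (\<Prod>i\<in>UNIV - {\<delta>}. 1 / (2 * pi))"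
  define \<kappa> where "\<kappa> = (\<lambda>(I, J) u. (c * reorder_sign J (I - J)) * gcoeff (nilexp (gaussian_soul w u)) (I - J))"
  show ?thesis
  proof (intro exI[of _ \<kappa>] conjI allI)
    have "gexp_growth (\<lambda>u. nilexp (gaussian_soul w u))"
      by (rule gexp_growth_nilexp[OF gexp_growth_soul])
    then show "exp_growth (\<kappa> K)" for K
      unfolding \<kappa>_def case_prod_beta gexp_growth_def
      by (intro exp_growth_mult exp_growth_const) blast
    fix g x y u I
    have "free_integrand w \<delta> g x y u = (c * exp (gaussian_body w x y u)) *\<^sub>R
        (g x y u * nilexp (gaussian_soul w u))"
      unfolding free_integrand_def gtaylor_gaussian c_def[symmetric]
      by (simp add: of_real_def mult_ac)
    then show "gcoeff (free_integrand w \<delta> g x y u) I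
        = (\<Sum>J\<in>Pow I. gcoeff (g x y u) J * (exp (gaussian_body w x y u) * \<kappa> (I, J) u))"
      by (simp only: gcoeff_scaleR gcoeff_mult sum_distrib_left \<kappa>_def case_prod_conv)
        (intro sum.cong refl, simp only: mult_ac)
  qed
qed

lemma free_integrand_continuous:
  fixes w :: "'v::finite \<Rightarrow> 'v \<Rightarrow> real"
  assumes g: "test_function g"
  shows "continuous_on UNIV (\<lambda>((x, y), u). gcoeff (free_integrand w \<delta> g x y u) I)"
proof -
  obtain \<kappa> where "(\<forall>K. exp_growth (\<kappa> K)) \<and> (\<forall>g x y u I. gcoeff (free_integrand w \<delta> g x y u) I
      = (\<Sum>J\<in>Pow I. gcoeff (g x y u) J * (exp (gaussian_body w x y u) * \<kappa> (I, J) u)))"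
    using free_integrand_coeff[of w \<delta>] ..
  note \<kappa> = this[THEN conjunct1, rule_format] this[THEN conjunct2, rule_format]
  have cont_u: "continuous_on UNIV (\<lambda>p :: ((real ^ 'v) \<times> (real ^ 'v)) \<times> (real ^ 'v). \<phi> (snd p))"
    if "exp_growth \<phi>" for \<phi> :: "real ^ 'v \<Rightarrow> real"
  proof -
    have "continuous_on UNIV \<phi>"
      using that by (simp add: exp_growth_def)
    then show ?thesis
      by (rule continuous_on_compose2) (auto intro!: continuous_intros)
  qed
  have "continuous_on UNIV (\<lambda>p. gaussian_body w (fst (fst p)) (snd (fst p)) (snd p))"
    unfolding gaussian_body_def by (intro continuous_intros cont_u exp_growth_A_matrix)
  then show ?thesis
    unfolding case_prod_beta \<kappa>(2)
    by (intro continuous_on_sum continuous_on_mult continuous_on_exp cont_u \<kappa>(1)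
        test_function_continuous[OF g, unfolded case_prod_beta])
qed

lemma mixing_density_continuous:
  assumes w: "connected_weighted_graph w"
  shows "continuous_on UNIV (mixing_density exp w a (\<lambda>_. 1 :: real))"
proof -
  obtain \<tau> where \<tau>: "exp_growth \<tau> \<and> (\<forall>u. \<tau> u \<ge> 0) \<and>
      (\<forall>u. mixing_density exp w a (\<lambda>_. 1) u = exp (- cosh_energy w u) * \<tau> u)"
    using mixing_density_growth[OF w, of a] ..
  then have "continuous_on UNIV \<tau>" by (simp add: exp_growth_def)
  then have "continuous_on UNIV (\<lambda>u. exp (- cosh_energy w u) * \<tau> u)"
    unfolding cosh_energy_def case_prod_beta by (intro continuous_intros) auto
  moreover have "mixing_density exp w a (\<lambda>_. 1 :: real) = (\<lambda>u. exp (- cosh_energy w u) * \<tau> u)"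
    using \<tau> by blast
  ultimately show ?thesis by simp
qed

text \<open>
  The rapid decay of \<open>g\<close> gives integrability in \<open>x\<close>, \<open>y\<close> and \<open>u\<close>, the Gaussian is at most 1, and the
  energy beats the exponentially growing factors in \<open>u\<close>.
\<close>

lemma weighted_free_integrand_bound:
  assumes w: "connected_weighted_graph w" and g: "test_function g"
  shows "\<exists>C. \<forall>x y u. u $ a = 0 \<longrightarrow>
    \<bar>mixing_density exp w a (\<lambda>_. 1) u * gcoeff (free_integrand w \<delta> g x y u) I\<bar>
    \<le> C * (decay_weight \<delta> x * decay_weight \<delta> y * decay_weight a u)"
proof -
  obtain \<kappa> where "(\<forall>K. exp_growth (\<kappa> K)) \<and> (\<forall>g x y u I. gcoeff (free_integrand w \<delta> g x y u) I
      = (\<Sum>J\<in>Pow I. gcoeff (g x y u) J * (exp (gaussian_body w x y u) * \<kappa> (I, J) u)))"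
    using free_integrand_coeff[of w \<delta>] ..
  note \<kappa> = this[THEN conjunct1, rule_format] this[THEN conjunct2, rule_format]
  obtain \<tau> where "exp_growth \<tau> \<and> (\<forall>u. \<tau> u \<ge> 0) \<and>
      (\<forall>u. mixing_density exp w a (\<lambda>_. 1) u = exp (- cosh_energy w u) * \<tau> u)"
    using mixing_density_growth[OF w, of a] ..
  then have \<tau>: "exp_growth \<tau>" "\<And>u. mixing_density exp w a (\<lambda>_. 1) u = exp (- cosh_energy w u) * \<tau> u"
    by blast+
  obtain D where D: "\<And>K u. u $ a = 0 \<Longrightarrow> \<bar>exp (- cosh_energy w u) * (\<tau> u * \<kappa> K u)\<bar> \<le> D K"
    using exp_energy_bound[OF w exp_growth_mult[OF \<tau>(1) \<kappa>(1)], where a = a] by metis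
  obtain C where C: "\<And>J. C J \<ge> 0"
    "\<And>J x y u. \<bar>gcoeff (g x y u) J\<bar> \<le> C J * (decay_weight \<delta> x * decay_weight \<delta> y * decay_weight a u)"
    using test_function_bound[OF g, of _ \<delta> a] by metis
  have "\<bar>mixing_density exp w a (\<lambda>_. 1) u * gcoeff (free_integrand w \<delta> g x y u) I\<bar>
      \<le> (\<Sum>J\<in>Pow I. C J * D (I, J)) * (decay_weight \<delta> x * decay_weight \<delta> y * decay_weight a u)"
    if u: "u $ a = 0" for x y u
  proof -
    have "mixing_density exp w a (\<lambda>_. 1) u * gcoeff (free_integrand w \<delta> g x y u) I = (\<Sum>J\<in>Pow I.
        gcoeff (g x y u) J * (exp (gaussian_body w x y u) * (exp (- cosh_energy w u) * (\<tau> u * \<kappa> (I, J) u))))"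
      unfolding \<tau>(2) \<kappa>(2) sum_distrib_left by (intro sum.cong refl) (simp only: mult_ac)
    also have "\<bar>\<dots>\<bar> \<le> (\<Sum>J\<in>Pow I. \<bar>gcoeff (g x y u) J\<bar> *
        (exp (gaussian_body w x y u) * \<bar>exp (- cosh_energy w u) * (\<tau> u * \<kappa> (I, J) u)\<bar>))"
      by (rule order_trans[OF sum_abs]) (simp add: abs_mult)
    also have "\<dots> \<le> (\<Sum>J\<in>Pow I. (C J * (decay_weight \<delta> x * decay_weight \<delta> y * decay_weight a u)) * (1 * D (I, J)))"
      by (intro sum_mono mult_mono C D u mult_nonneg_nonneg)
        (auto simp: C gaussian_body_nonpos[OF w])
    also have "\<dots> = (\<Sum>J\<in>Pow I. C J * D (I, J)) * (decay_weight \<delta> x * decay_weight \<delta> y * decay_weight a u)"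
      unfolding sum_distrib_right by (intro sum.cong refl) (simp only: mult_ac mult_1)
    finally show ?thesis .
  qed
  then show ?thesis by blast
qed


lemma free_integrand_measurable:
  assumes "test_function g"
  shows "(\<lambda>((x, y), u). gcoeff (free_integrand w \<delta> g x y u) I) \<in> borel_measurable
    ((pinned_lebesgue \<delta> c \<Otimes>\<^sub>M pinned_lebesgue \<delta> d) \<Otimes>\<^sub>M pinned_lebesgue a e)"
proof -
  have sets: "sets ((pinned_lebesgue \<delta> c \<Otimes>\<^sub>M pinned_lebesgue \<delta> d) \<Otimes>\<^sub>M pinned_lebesgue a e)
    = sets (borel :: (((real ^ 'a) \<times> (real ^ 'a)) \<times> (real ^ 'a)) measure)"
    unfolding borel_prod[symmetric] by (intro sets_pair_measure_cong sets_pinned_lebesgue)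
  show ?thesis
    unfolding measurable_cong_sets[OF sets refl]
    by (rule borel_measurable_continuous_onI[OF free_integrand_continuous[OF assms]])
qed

lemma mixing_density_measurable:
  assumes "connected_weighted_graph w"
  shows "mixing_density exp w a (\<lambda>_. 1 :: real) \<in> borel_measurable (pinned_lebesgue k c)"
  unfolding measurable_cong_sets[OF sets_pinned_lebesgue refl]
  by (rule borel_measurable_continuous_onI[OF mixing_density_continuous[OF assms]])

lemma weighted_free_integrand_integrable:
  fixes w :: "'v::finite \<Rightarrow> 'v \<Rightarrow> real" and a \<delta> :: 'v
  assumes w: "connected_weighted_graph w" and g: "test_function g"
  defines "h \<equiv> \<lambda>I x y u. mixing_density exp w a (\<lambda>_. 1) u * gcoeff (free_integrand w \<delta> g x y u) I"
  shows "integrable ((pinned_lebesgue \<delta> c \<Otimes>\<^sub>M pinned_lebesgue \<delta> d) \<Otimes>\<^sub>M pinned_lebesgue a 0)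
      (\<lambda>p. h I (fst (fst p)) (snd (fst p)) (snd p))"
    and "integrable (pinned_lebesgue a 0) (\<lambda>u. h I x y u)"
proof -
  let ?M = "pinned_lebesgue \<delta> c \<Otimes>\<^sub>M pinned_lebesgue \<delta> d" and ?N = "pinned_lebesgue a 0"
  interpret M: pair_sigma_finite "pinned_lebesgue \<delta> c" "pinned_lebesgue \<delta> d"
    by (simp add: pair_sigma_finite_def sigma_finite_pinned_lebesgue)
  interpret MN: pair_sigma_finite ?M ?N
    by (simp add: pair_sigma_finite_def sigma_finite_pinned_lebesgue M.sigma_finite_measure_axioms)
  obtain C where C: "\<And>x y u. u $ a = 0 \<Longrightarrow> \<bar>h I x y u\<bar>
      \<le> C * (decay_weight \<delta> x * decay_weight \<delta> y * decay_weight a u)"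
    using weighted_free_integrand_bound[OF w g, of a \<delta> I] unfolding h_def by blast
  note meas_free [measurable] = free_integrand_measurable[OF g, where w = w and \<delta> = \<delta> and I = I and a = a
      and c = c and d = d and e = 0, unfolded case_prod_beta]
  note meas_mix [measurable] = mixing_density_measurable[OF w, of a a 0]
  have meas: "(\<lambda>p. h I (fst (fst p)) (snd (fst p)) (snd p)) \<in> borel_measurable (?M \<Otimes>\<^sub>M ?N)"
    unfolding h_def by measurable
  let ?b = "\<lambda>p. C * (decay_weight \<delta> (fst (fst p)) * decay_weight \<delta> (snd (fst p)) * decay_weight a (snd p))"
  have "integrable (?M \<Otimes>\<^sub>M ?N) (\<lambda>(p, u). (case p of (x, y) \<Rightarrow> decay_weight \<delta> x * decay_weight \<delta> y) * decay_weight a u)"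
    by (intro integrable_pair_mult sigma_finite_pinned_lebesgue integrable_decay_weight M.sigma_finite_measure_axioms)
  then have b: "integrable (?M \<Otimes>\<^sub>M ?N) ?b"
    unfolding case_prod_beta by (rule integrable_mult_right)
  have "{p \<in> space (?M \<Otimes>\<^sub>M ?N). snd p $ a = 0} \<in> sets (?M \<Otimes>\<^sub>M ?N)"
    by measurable
  then have AE: "AE p in ?M \<Otimes>\<^sub>M ?N. snd p $ a = 0"
    by (rule MN.AE_pair_measure) (simp add: AE_pinned_lebesgue)
  show "integrable (?M \<Otimes>\<^sub>M ?N) (\<lambda>p. h I (fst (fst p)) (snd (fst p)) (snd p))"
  proof (rule Bochner_Integration.integrable_bound[OF b meas])
    show "AE p in ?M \<Otimes>\<^sub>M ?N. norm (h I (fst (fst p)) (snd (fst p)) (snd p)) \<le> norm (?b p)"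
      using AE
    proof eventually_elim
      case (elim p)
      have "\<bar>h I (fst (fst p)) (snd (fst p)) (snd p)\<bar> \<le> ?b p"
        using elim by (rule C)
      then show ?case by simp
    qed
  qed
  have "(\<lambda>u. (\<lambda>p. h I (fst (fst p)) (snd (fst p)) (snd p)) ((x, y), u)) \<in> borel_measurable ?N"
    by (rule measurable_compose[OF _ meas]) (auto simp: space_pair_measure)
  then have meas_u: "(\<lambda>u. h I x y u) \<in> borel_measurable ?N"
    by simp
  have b_u: "integrable ?N (\<lambda>u. C * (decay_weight \<delta> x * decay_weight \<delta> y * decay_weight a u))"
    by (intro integrable_mult_right integrable_decay_weight)
  show "integrable ?N (\<lambda>u. h I x y u)"
  proof (rule Bochner_Integration.integrable_bound[OF b_u meas_u])
    show "AE u in ?N. norm (h I x y u) \<le> norm (C * (decay_weight \<delta> x * decay_weight \<delta> y * decay_weight a u))"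
      using AE_pinned_lebesgue
    proof eventually_elim
      case (elim u)
      have "\<bar>h I x y u\<bar> \<le> C * (decay_weight \<delta> x * decay_weight \<delta> y * decay_weight a u)"
        using elim by (rule C)
      then show ?case by simp
    qed
  qed
qed

text \<open>
  The identity for an arbitrary root \<open>\<delta>\<close> and an arbitrary pinning vertex \<open>a\<close> of the environment; for \<open>a = \<delta>\<close>
  the weight \<open>z\<^sub>a / z\<^sub>\<delta>\<close> is 1.
\<close>

lemma H22_mixing_identity:
  fixes w :: "'v::finite \<Rightarrow> 'v \<Rightarrow> real"
  assumes w: "connected_weighted_graph w" and g: "test_function g"
  shows "H22_expectation w \<delta> s (\<lambda>x y. z_field x y a * gtaylor inverse (z_field x y \<delta>)
            * mixing_gintegral w a (z_field x y) (g x y))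
        = (\<integral>u. free_expectation (A_matrix w u) \<delta> s (\<lambda>x y. g x y u) \<partial>mixing_measure w a (\<lambda>_. 1))"
proof -
  let ?M = "pinned_lebesgue \<delta> (sinh s) \<Otimes>\<^sub>M pinned_lebesgue \<delta> 0" and ?N = "pinned_lebesgue a 0"
  interpret M: pair_sigma_finite "pinned_lebesgue \<delta> (sinh s)" "pinned_lebesgue \<delta> 0"
    by (simp add: pair_sigma_finite_def sigma_finite_pinned_lebesgue)
  interpret MN: pair_sigma_finite ?M ?N
    by (simp add: pair_sigma_finite_def sigma_finite_pinned_lebesgue M.sigma_finite_measure_axioms)
  define m where "m u = mixing_density exp w a (\<lambda>_. 1 :: real) u" for u
  define F where "F x y u = m u *\<^sub>R free_integrand w \<delta> g x y u" for x y u
  define f where "f p u = super_body \<delta> (free_integrand w \<delta> g (fst p) (snd p) u)" for p u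
  have mf: "super_body \<delta> (F x y u) = m u * f (x, y) u" for x y u
    by (simp add: F_def f_def linear_cmul[OF linear_super_body])
  have m_eq: "m = mixing_density exp w a (\<lambda>_. 1)"
    by (rule ext) (rule m_def)
  note integrable = weighted_free_integrand_integrable[OF w g, where a = a and \<delta> = \<delta>, folded m_def]
  have F_integrable: "integrable ?N (\<lambda>u. gcoeff (F x y u) I)" for x y I
    unfolding F_def gcoeff_scaleR by (rule integrable(2))
  have "integrable (?M \<Otimes>\<^sub>M ?N) (\<lambda>p. m (snd p) * f (fst p) (snd p))"
    unfolding f_def super_body_expansion[of \<delta> "free_integrand _ _ _ _ _ _"] sum_distrib_left mult.assoc[symmetric]
    by (intro Bochner_Integration.integrable_sum integrable_mult_left integrable(1))
  then have mf_integrable: "integrable (?M \<Otimes>\<^sub>M ?N) (\<lambda>(p, u). m u * f p u)"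
    by (simp only: case_prod_unfold)
  have f_meas: "case_prod (\<lambda>u p. f p u) \<in> borel_measurable (?N \<Otimes>\<^sub>M ?M)"
  proof -
    note [measurable] = free_integrand_measurable[OF g, unfolded case_prod_beta]
    have "(\<lambda>p. f (fst p) (snd p)) \<in> borel_measurable (?M \<Otimes>\<^sub>M ?N)"
      unfolding f_def super_body_expansion[of \<delta> "free_integrand _ _ _ _ _ _"]
      by (intro borel_measurable_sum borel_measurable_times borel_measurable_const) measurable
    from measurable_compose[OF measurable_pair_swap' this] show ?thesis
      by (simp add: case_prod_beta)
  qed

  have "H22_expectation w \<delta> s (\<lambda>x y. z_field x y a * gtaylor inverse (z_field x y \<delta>)
            * mixing_gintegral w a (z_field x y) (g x y))
      = (\<integral>(x, y). super_body \<delta> (gintegral ?N (F x y)) \<partial>?M)"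
  proof -
    have "z_field x y a * gtaylor inverse (z_field x y \<delta>) * mixing_gintegral w a (z_field x y) (g x y)
        * gtaylor exp (H22_exponent w x y)
        * oprod (UNIV - {\<delta>}) (\<lambda>i. (1 / (2 * pi)) *\<^sub>R gtaylor inverse (z_field x y i))
      = gintegral ?N (F x y)" for x y
      using H22_mixing_integrand[OF w F_integrable[unfolded F_def free_integrand_def m_def]]
      unfolding F_def[abs_def] free_integrand_def m_def .
    then show ?thesis
      by (simp add: H22_expectation_def super_integral_def super_body_def H22_exponent_def)
  qed
  also have "\<dots> = (\<integral>p. (\<integral>u. m u * f p u \<partial>?N) \<partial>?M)"
    by (simp add: super_body_gintegral[OF F_integrable] mf case_prod_unfold)
  also have "\<dots> = (\<integral>u. (\<integral>p. m u * f p u \<partial>?M) \<partial>?N)"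
    by (rule MN.Fubini_integral[OF mf_integrable, symmetric])
  also have "\<dots> = (\<integral>u. m u * (\<integral>p. f p u \<partial>?M) \<partial>?N)"
    by simp
  also have "\<dots> = (\<integral>u. (\<integral>p. f p u \<partial>?M) \<partial>mixing_measure w a (\<lambda>_. 1))"
    unfolding mixing_measure_def m_def[symmetric]
  proof (rule integral_real_density[symmetric])
    show "m \<in> borel_measurable ?N"
      unfolding m_eq by (rule mixing_density_measurable[OF w])
    show "AE u in ?N. 0 \<le> m u"
      using mixing_density_growth[OF w, of a] by (auto simp: m_def)
    show "(\<lambda>u. \<integral>p. f p u \<partial>?M) \<in> borel_measurable ?N"
      by (rule M.borel_measurable_lebesgue_integral[OF f_meas])
  qed
  also have "\<dots> = (\<integral>u. free_expectation (A_matrix w u) \<delta> s (\<lambda>x y. g x y u) \<partial>mixing_measure w a (\<lambda>_. 1))"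
    unfolding f_def free_expectation_def super_integral_def super_body_def free_integrand_def gaussian_exponent_def
    by (simp add: case_prod_unfold)
  finally show ?thesis .
qed

theorem theorem7:
  shows
    "(\<forall>(W :: 'v::finite \<Rightarrow> 'v \<Rightarrow> real) \<delta> a s g.
        connected_weighted_graph W \<and> test_function g \<longrightarrow>
        H22_expectation W \<delta> s (\<lambda>x y. z_field x y a * gtaylor inverse (z_field x y \<delta>)
            * mixing_gintegral W a (z_field x y) (g x y))
        = (\<integral>u. free_expectation (A_matrix W u) \<delta> s (\<lambda>x y. g x y u) \<partial>mixing_measure W a (\<lambda>_. 1)))
     \<and>
     (\<forall>(W :: 'w::finite \<Rightarrow> 'w \<Rightarrow> real) \<delta> b s g.
        connected_weighted_graph W \<and> test_function g \<longrightarrow>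
        H22_expectation W \<delta> s (\<lambda>x y. z_field x y b * gtaylor inverse (z_field x y \<delta>)
            * mixing_gintegral W b (z_field x y) (g x y))
        = (\<integral>u. free_expectation (A_matrix W u) \<delta> s (\<lambda>x y. g x y u) \<partial>mixing_measure W b (\<lambda>_. 1))
        \<and>
        (b = \<delta> \<longrightarrow>
          H22_expectation W \<delta> s (\<lambda>x y. mixing_gintegral W b (z_field x y) (g x y))
          = (\<integral>u. free_expectation (A_matrix W u) \<delta> s (\<lambda>x y. g x y u) \<partial>mixing_measure W b (\<lambda>_. 1))))"
proof (intro conjI allI impI, goal_cases)
  case (1 W \<delta> a s g)
  then show ?case
    by (intro H22_mixing_identity) auto
next
  case (2 W \<delta> b s g)
  then show ?case
    by (intro H22_mixing_identity) auto
next
  case (3 W \<delta> b s g)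
  then have "H22_expectation W \<delta> s (\<lambda>x y. z_field x y b * gtaylor inverse (z_field x y \<delta>)
        * mixing_gintegral W b (z_field x y) (g x y))
      = (\<integral>u. free_expectation (A_matrix W u) \<delta> s (\<lambda>x y. g x y u) \<partial>mixing_measure W b (\<lambda>_. 1))"
    by (intro H22_mixing_identity) auto
  then show ?case
    using 3 by (simp add: z_field_inverse)
qed

end
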